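(* Suppose that $\eta_{u,\star}$ and $\eta_{z,\star}$ satisfy the axioms (A1), (A2), (A3), (A4) (with the same constants for $w=u$ and $w=z$), where (A3) is understood along the sequence generated by Algorithm 3. Suppose that the mesh-refinement satisfies the son estimate (M1), the mesh-closure estimate (M2), and the overlay estimate (M3). Let $\theta_\star:=(1+C_{\rm stb}^2C_{\rm rel}^2)^{-1}$. For any marking parameter $0<\theta<\theta_\star/2$, Algorithm 3 guarantees optimal algebraic convergence rates in the following sense: (i) There exists a constant $C_{\rm opt}>0$, which depends only on $\theta$, $C_{\rm mark}$, $C_{\rm mesh}$, and the constants in (A1)--(A4), such that for all $s,t>0$ the assumption $(u,z)\in\mathbb A_s\times\mathbb A_t$ implies, for all $\ell\in\mathbb N_0$, $$\eta_{u,\ell}\,\eta_{z,\ell}\le\frac{C_{\rm opt}^{\,1+s+t}}{\big(1-q_{\rm lin}^{1/(s+t)}\big)^{s+t}}\;\|u\|_{\mathbb A_s}\|z\|_{\mathbb A_t}\,(\#\mathcal T_\ell-\#\mathcal T_0)^{-(s+t)} ,$$ where $0<q_{\rm lin}<1$ is the linear convergence constant described in the context. (ii) If $s_{\max}:=\sup\{s>0:\|u\|_{\mathbb A_s}<\infty\}<\infty$ and $t_{\max}:=\sup\{t>0:\|z\|_{\mathbb A_t}<\infty\}<\infty$, then for all $0<s<s_{\max}$ and $0<t<t_{\max}$ there is a constant $C>0$ (which may additionally depend on $s_{\max}-s>0$ resp. $t_{\max}-t>0$) such that for all $\ell\in\mathbb N$ $$\eta_{u,\ell}\le C\,(\#\mathcal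 T_\ell-\#\mathcal T_0)^{-s}\quad\text{and}\quad\eta_{z,\ell}\le C\,(\#\mathcal T_\ell-\#\mathcal T_0)^{-t}.$$
   Context: **Mesh refinement.** A triangulation is a finite set of elements. A fixed deterministic mesh-refinement strategy is given: for a triangulation $\mathcal T$ and $\mathcal M\subseteq\mathcal T$, $\mathtt{refine}(\mathcal T,\mathcal M)$ is the coarsest triangulation in which all elements of $\mathcal M$ have been refined (so $\mathcal M\subseteq\mathcal T\setminus\mathtt{refine}(\mathcal T,\mathcal M)$; further elements may be refined, e.g. to preserve conformity or shape regularity). Write $\mathcal T'\in\mathtt{refine}(\mathcal T)$ if $\mathcal T'$ is obtained from $\mathcal T$ by finitely many (possibly zero) such refinement steps. $\mathcal T_0$ is a given initial triangulation and $\mathbb T:=\mathtt{refine}(\mathcal T_0)$. **Mesh properties.** (M1) $\#(\mathcal T\setminus\mathcal T')+\#\mathcal T\le\#\mathcal T'$ for all $\mathcal T\in\mathbb T$, $\mathcal T'\in\mathtt{refine}(\mathcal T)$. (M2) $\#\mathcal T_\ell-\#\mathcal T_0\le C_{\rm mesh}\sum_{j=0}^{\ell-1}\#\mathcal M_j$ for all $\ell\in\mathbb N$, where $\mathcal M_j$ are the marked sets and $C_{\rm mesh}>0$ depends only on $\mathcal T_0$. (M3) For all $\mathcal T,\mathcal T'\in\mathbb T$ there is a common refinement $\mathcal T\oplus\mathcal T'\in\mathtt{refine}(\mathcal T)\cap\mathtt{refine}(\mathcal T')$ with $\#(\mathcal T\oplus\mathcal T')\le\#\mathcal T+\#\mathcal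 T'-\#\mathcal T_0$. **Estimators.** Here $u,z$ are two labels. For $w\in\{u,z\}$ and each $\mathcal T_\star\in\mathbb T$ there are local contributions $\eta_{w,\star}(T)\ge0$, $T\in\mathcal T_\star$. Put $\eta_{w,\star}(\mathcal U)=\big(\sum_{T\in\mathcal U}\eta_{w,\star}(T)^2\big)^{1/2}$ for $\mathcal U\subseteq\mathcal T_\star$ and $\eta_{w,\star}=\eta_{w,\star}(\mathcal T_\star)$. The index of $\eta$ matches that of the triangulation (e.g. $\eta_{w,\ell}$ belongs to $\mathcal T_\ell$). **Distance.** $\mathrm d_w:\mathbb T\times\mathbb T\to\mathbb R_{\ge0}$ satisfies, with a constant $C_{\rm dist}>0$, $C_{\rm dist}^{-1}\mathrm d_w(\mathcal T,\mathcal T'')\le \mathrm d_w(\mathcal T,\mathcal T')+\mathrm d_w(\mathcal T',\mathcal T'')$ and $\mathrm d_w(\mathcal T,\mathcal T')\le C_{\rm dist}\,\mathrm d_w(\mathcal T',\mathcal T)$ for all $\mathcal T,\mathcal T',\mathcal T''\in\mathbb T$. ($C_{\rm dist}$ is counted among the constants of the axioms.) **Axioms** (for $w\in\{u,z\}$): (A1) There is $C_{\rm stb}>0$ such that for all $\mathcal T_\ell\in\mathbb T$, $\mathcal T_\star\in\mathtt{refine}(\mathcal T_\ell)$: $|\eta_{w,\star}(\mathcal T_\ell\cap\mathcal T_\star)-\eta_{w,\ell}(\mathcal T_\ell\cap\mathcal T_\star)|\le C_{\rm stb}\,\mathrm d_w(\mathcal T_\ell,\mathcal T_\star)$. (A2)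 There are $0<q_{\rm red}<1$, $C_{\rm red}>0$ such that for all $\mathcal T_\ell\in\mathbb T$, $\mathcal T_\star\in\mathtt{refine}(\mathcal T_\ell)$: $\eta_{w,\star}(\mathcal T_\star\setminus\mathcal T_\ell)^2\le q_{\rm red}\,\eta_{w,\ell}(\mathcal T_\ell\setminus\mathcal T_\star)^2+C_{\rm red}\,\mathrm d_w(\mathcal T_\ell,\mathcal T_\star)^2$. (A3) (along a given sequence $(\mathcal T_\ell)_{\ell\in\mathbb N_0}$ of successively refined triangulations and for given $\theta$) Let $(\mathcal T_{\ell_n})_n$ be the (possibly finite) subsequence of those $\mathcal T_\ell$ with $\theta\,\eta_{w,\ell}^2\le\eta_{w,\ell}(\mathcal T_\ell\setminus\mathcal T_{\ell+1})^2$. For all $\varepsilon>0$ there is $C_{\rm orth}(\varepsilon)>0$ such that for all $n\le N$ for which $\mathcal T_{\ell_n},\dots,\mathcal T_{\ell_{N+1}}$ are well-defined: $\sum_{j=n}^N\big(\mathrm d_w(\mathcal T_{\ell_{j+1}},\mathcal T_{\ell_j})^2-\varepsilon\,\eta_{w,\ell_j}^2\big)\le C_{\rm orth}(\varepsilon)\,\eta_{w,\ell_n}^2$. (A4) There is $C_{\rm rel}>0$ such that for all $\mathcal T_\ell\in\mathbb T$, $\mathcal T_\star\in\mathtt{refine}(\mathcal T_\ell)$: $\mathrm d_w(\mathcal T_\star,\mathcal T_\ell)\le C_{\rm rel}\,\eta_{w,\ell}(\mathcal R_w(\mathcal T_\ell,\mathcal T_\star))$, where $\mathcal T_\ell\setminus\mathcal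 T_\star\subseteq\mathcal R_w(\mathcal T_\ell,\mathcal T_\star)\subseteq\mathcal T_\ell$ and $\#\mathcal R_w(\mathcal T_\ell,\mathcal T_\star)\le C_{\rm rel}\,\#(\mathcal T_\ell\setminus\mathcal T_\star)$. **Algorithm 3.** Input: $\mathcal T_0$, $0<\theta\le1$, $C_{\rm mark}\ge1$. For $\ell=0,1,2,\dots$: compute $\eta_{u,\ell}(T),\eta_{z,\ell}(T)$ for all $T\in\mathcal T_\ell$; put $\rho_\ell(T)^2:=\eta_{u,\ell}(T)^2\eta_{z,\ell}^2+\eta_{u,\ell}^2\eta_{z,\ell}(T)^2$, $\rho_\ell(\mathcal U)^2:=\sum_{T\in\mathcal U}\rho_\ell(T)^2$, $\rho_\ell:=\rho_\ell(\mathcal T_\ell)$; determine $\mathcal M_\ell\subseteq\mathcal T_\ell$ with $\theta\rho_\ell^2\le\rho_\ell(\mathcal M_\ell)^2$ whose cardinality is at most $C_{\rm mark}$ times the minimal cardinality of all subsets of $\mathcal T_\ell$ with this property; set $\mathcal T_{\ell+1}:=\mathtt{refine}(\mathcal T_\ell,\mathcal M_\ell)$. **Linear convergence constants.** $C_{\rm lin}>0$ and $0<q_{\rm lin}<1$ denote constants depending only on $\theta$ and the constants in (A1)--(A4) such that the sequence generated by Algorithm 3 satisfies $\eta_{u,\ell+n}\eta_{z,\ell+n}\le C_{\rm lin}q_{\rm lin}^n\eta_{u,\ell}\eta_{z,\ell}$ for all $\ell,n\in\mathbb N_0$ (such constants exist under (A1)--(A4)). **Approximation classes.** $\mathbb T_N:=\{\mathcal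 T\in\mathbb T:\#\mathcal T-\#\mathcal T_0\le N\}$ (a finite set). For $s>0$ and $w\in\{u,z\}$, $w\in\mathbb A_s$ means $\|w\|_{\mathbb A_s}:=\sup_{N\in\mathbb N_0}\big((N+1)^s\min_{\mathcal T_\star\in\mathbb T_N}\eta_{w,\star}\big)<\infty$. Right-hand sides containing a negative power of $\#\mathcal T_\ell-\#\mathcal T_0$ are read as $+\infty$ if $\#\mathcal T_\ell=\#\mathcal T_0$.
   Formalization: (A1) is taken with d_w(T_⋆,T_ℓ) in place of d_w(T_ℓ,T_⋆); (ii) also assumes that for each r>s_max (resp. t_max) the best estimator over T_N is ≥ c(N+1)^{-r} for all N, for both u and z; refined elements never reappear in later refinements. As worded, (i) and (ii) can fail. *)

theory Defs
  imports Complex_Main "HOL-Library.Extended_Real" "HOL-Library.Infinite_Set"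
begin

section \<open>Mesh refinement\<close>

type_synonym 'e mesh = "'e set"

inductive_set refinements :: "('e mesh \<Rightarrow> 'e mesh \<Rightarrow> 'e mesh) \<Rightarrow> 'e mesh \<Rightarrow> 'e mesh set"
  for refine :: "'e mesh \<Rightarrow> 'e mesh \<Rightarrow> 'e mesh" and T :: "'e mesh"
where
  refl: "T \<in> refinements refine T"
| step: "T' \<in> refinements refine T \<Longrightarrow> M \<subseteq> T' \<Longrightarrow> refine T' M \<in> refinements refine T"

text \<open>
  The second conjunct says that \<open>refine T M\<close> is the coarsest refinement of \<open>T\<close> in which all
  elements of \<open>M\<close> have been refined.  The third one expresses that refining an element replaces
  it for good: an element of \<open>T\<close> that is no longer present in a refinement \<open>T'\<close> does not
  reappear in any further refinement of \<open>T'\<close>.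
\<close>
definition mesh_strategy :: "('e mesh \<Rightarrow> 'e mesh \<Rightarrow> 'e mesh) \<Rightarrow> 'e mesh \<Rightarrow> bool" where
  "mesh_strategy refine T0 \<longleftrightarrow>
     finite T0 \<and>
     (\<forall>T\<in>refinements refine T0. \<forall>M. M \<subseteq> T \<longrightarrow>
        finite (refine T M) \<and> M \<subseteq> T - refine T M \<and>
        (\<forall>T'\<in>refinements refine T. M \<subseteq> T - T' \<longrightarrow> T' \<in> refinements refine (refine T M))) \<and>
     (\<forall>T\<in>refinements refine T0. \<forall>T'\<in>refinements refine T. \<forall>T''\<in>refinements refine T'.
        T \<inter> T'' \<subseteq> T')"

definition son_estimate :: "('e mesh \<Rightarrow> 'e mesh \<Rightarrow> 'e mesh) \<Rightarrow> 'e mesh \<Rightarrow> bool" where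
  "son_estimate refine T0 \<longleftrightarrow>
     (\<forall>T\<in>refinements refine T0. \<forall>T'\<in>refinements refine T.
        card (T - T') + card T \<le> card T')"

text \<open>A property of the refinement strategy alone: it is required for arbitrary marked sets,
  not just for those selected by a particular marking criterion.\<close>
definition closure_estimate ::
  "real \<Rightarrow> ('e mesh \<Rightarrow> 'e mesh \<Rightarrow> 'e mesh) \<Rightarrow> 'e mesh \<Rightarrow> bool" where
  "closure_estimate C\<^sub>m\<^sub>e\<^sub>s\<^sub>h refine T0 \<longleftrightarrow>
     (\<forall>T M. T 0 = T0 \<and> (\<forall>l::nat. M l \<subseteq> T l \<and> T (Suc l) = refine (T l) (M l)) \<longrightarrow>
        (\<forall>l. real (card (T l)) - real (card T0) \<le> C\<^sub>m\<^sub>e\<^sub>s\<^sub>h * (\<Sum>j<l. real (card (M j)))))"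

definition overlay_estimate :: "('e mesh \<Rightarrow> 'e mesh \<Rightarrow> 'e mesh) \<Rightarrow> 'e mesh \<Rightarrow> bool" where
  "overlay_estimate refine T0 \<longleftrightarrow>
     (\<forall>T\<in>refinements refine T0. \<forall>T'\<in>refinements refine T0.
        \<exists>T''\<in>refinements refine T \<inter> refinements refine T'.
          real (card T'') \<le> real (card T) + real (card T') - real (card T0))"


section \<open>Estimators, distance, and axioms\<close>

text \<open>The labels \<open>u\<close> and \<open>z\<close>.\<close>
datatype label = Primal | Dual

text \<open>\<open>e T K\<close> is the contribution of the element \<open>K \<in> T\<close> to the estimator on the mesh \<open>T\<close>.\<close>
type_synonym 'e estimator = "'e mesh \<Rightarrow> 'e \<Rightarrow> real"
type_synonym 'e distance = "'e mesh \<Rightarrow> 'e mesh \<Rightarrow> real"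

definition est :: "'e estimator \<Rightarrow> 'e mesh \<Rightarrow> 'e mesh \<Rightarrow> real" where
  "est e T U = sqrt (\<Sum>K\<in>U. (e T K)\<^sup>2)"

abbreviation total_est :: "'e estimator \<Rightarrow> 'e mesh \<Rightarrow> real" where
  "total_est e T \<equiv> est e T T"

definition nonneg_estimator ::
  "('e mesh \<Rightarrow> 'e mesh \<Rightarrow> 'e mesh) \<Rightarrow> 'e mesh \<Rightarrow> 'e estimator \<Rightarrow> bool" where
  "nonneg_estimator refine T0 e \<longleftrightarrow> (\<forall>T\<in>refinements refine T0. \<forall>K\<in>T. 0 \<le> e T K)"

definition quasi_distance ::
  "real \<Rightarrow> ('e mesh \<Rightarrow> 'e mesh \<Rightarrow> 'e mesh) \<Rightarrow> 'e mesh \<Rightarrow> 'e distance \<Rightarrow> bool" where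
  "quasi_distance C\<^sub>d\<^sub>i\<^sub>s\<^sub>t refine T0 d \<longleftrightarrow>
     (\<forall>T\<in>refinements refine T0. \<forall>T'\<in>refinements refine T0.
        0 \<le> d T T' \<and> d T T' \<le> C\<^sub>d\<^sub>i\<^sub>s\<^sub>t * d T' T \<and>
        (\<forall>T''\<in>refinements refine T0. inverse C\<^sub>d\<^sub>i\<^sub>s\<^sub>t * d T T'' \<le> d T T' + d T' T''))"

text \<open>
  The finer mesh is the first argument of \<open>d\<close> here, as in reliability and quasi-orthogonality
  below.  For symmetric \<open>d\<close> the order is irrelevant, and for a quasi-symmetric one it amounts to
  a factor \<open>C\<^sub>d\<^sub>i\<^sub>s\<^sub>t\<close> in \<open>C\<^sub>s\<^sub>t\<^sub>b\<close>; but stability and reliability must use the same order for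
  \<open>1 / (1 + C\<^sub>s\<^sub>t\<^sub>b\<^sup>2 C\<^sub>r\<^sub>e\<^sub>l\<^sup>2)\<close> to be an admissible threshold, since otherwise the product
  \<open>C\<^sub>s\<^sub>t\<^sub>b C\<^sub>r\<^sub>e\<^sub>l\<close> could be made small by making \<open>d\<close> asymmetric.
\<close>
definition stability ::
  "real \<Rightarrow> ('e mesh \<Rightarrow> 'e mesh \<Rightarrow> 'e mesh) \<Rightarrow> 'e mesh \<Rightarrow> 'e estimator \<Rightarrow> 'e distance \<Rightarrow> bool" where
  "stability C\<^sub>s\<^sub>t\<^sub>b refine T0 e d \<longleftrightarrow>
     (\<forall>T\<in>refinements refine T0. \<forall>T'\<in>refinements refine T.
        \<bar>est e T' (T \<inter> T') - est e T (T \<inter> T')\<bar> \<le> C\<^sub>s\<^sub>t\<^sub>b * d T' T)"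

definition reduction ::
  "real \<Rightarrow> real \<Rightarrow> ('e mesh \<Rightarrow> 'e mesh \<Rightarrow> 'e mesh) \<Rightarrow> 'e mesh \<Rightarrow> 'e estimator \<Rightarrow> 'e distance \<Rightarrow> bool"
where
  "reduction q\<^sub>r\<^sub>e\<^sub>d C\<^sub>r\<^sub>e\<^sub>d refine T0 e d \<longleftrightarrow>
     (\<forall>T\<in>refinements refine T0. \<forall>T'\<in>refinements refine T.
        (est e T' (T' - T))\<^sup>2 \<le> q\<^sub>r\<^sub>e\<^sub>d * (est e T (T - T'))\<^sup>2 + C\<^sub>r\<^sub>e\<^sub>d * (d T T')\<^sup>2)"

definition reliability ::
  "real \<Rightarrow> ('e mesh \<Rightarrow> 'e mesh \<Rightarrow> 'e mesh) \<Rightarrow> 'e mesh \<Rightarrow> 'e estimator \<Rightarrow> 'e distance \<Rightarrow> bool" where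
  "reliability C\<^sub>r\<^sub>e\<^sub>l refine T0 e d \<longleftrightarrow>
     (\<forall>T\<in>refinements refine T0. \<forall>T'\<in>refinements refine T.
        \<exists>R. T - T' \<subseteq> R \<and> R \<subseteq> T \<and> real (card R) \<le> C\<^sub>r\<^sub>e\<^sub>l * real (card (T - T')) \<and>
            d T' T \<le> C\<^sub>r\<^sub>e\<^sub>l * est e T R)"

definition doerfler_steps :: "real \<Rightarrow> 'e estimator \<Rightarrow> (nat \<Rightarrow> 'e mesh) \<Rightarrow> nat set" where
  "doerfler_steps \<theta> e T =
     {l. \<theta> * (total_est e (T l))\<^sup>2 \<le> (est e (T l) (T l - T (Suc l)))\<^sup>2}"

text \<open>\<open>enumerate D j\<close> is the \<open>j\<close>-th element of \<open>D\<close> in increasing order (counted from 0); for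
  finite \<open>D\<close> it is meaningful only if \<open>j < card D\<close>.\<close>
definition quasi_orthogonality ::
  "(real \<Rightarrow> real) \<Rightarrow> real \<Rightarrow> (nat \<Rightarrow> 'e mesh) \<Rightarrow> 'e estimator \<Rightarrow> 'e distance \<Rightarrow> bool" where
  "quasi_orthogonality C\<^sub>o\<^sub>r\<^sub>t\<^sub>h \<theta> T e d \<longleftrightarrow>
     (let D = doerfler_steps \<theta> e T; S = (\<lambda>j. T (enumerate D j)) in
      \<forall>\<epsilon>>0. \<forall>n N. n \<le> N \<and> (infinite D \<or> Suc N < card D) \<longrightarrow>
        (\<Sum>j=n..N. (d (S (Suc j)) (S j))\<^sup>2 - \<epsilon> * (total_est e (S j))\<^sup>2)
          \<le> C\<^sub>o\<^sub>r\<^sub>t\<^sub>h \<epsilon> * (total_est e (S n))\<^sup>2)"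


section \<open>The adaptive algorithm\<close>

definition rho_sq :: "'e estimator \<Rightarrow> 'e estimator \<Rightarrow> 'e mesh \<Rightarrow> 'e mesh \<Rightarrow> real" where
  "rho_sq e\<^sub>u e\<^sub>z T U =
     (\<Sum>K\<in>U. (e\<^sub>u T K)\<^sup>2 * (total_est e\<^sub>z T)\<^sup>2 + (total_est e\<^sub>u T)\<^sup>2 * (e\<^sub>z T K)\<^sup>2)"

definition goal_algorithm ::
  "real \<Rightarrow> real \<Rightarrow> ('e mesh \<Rightarrow> 'e mesh \<Rightarrow> 'e mesh) \<Rightarrow> 'e mesh \<Rightarrow> 'e estimator \<Rightarrow> 'e estimator
     \<Rightarrow> (nat \<Rightarrow> 'e mesh) \<Rightarrow> (nat \<Rightarrow> 'e mesh) \<Rightarrow> bool" where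
  "goal_algorithm \<theta> C\<^sub>m\<^sub>a\<^sub>r\<^sub>k refine T0 e\<^sub>u e\<^sub>z T M \<longleftrightarrow>
     T 0 = T0 \<and>
     (\<forall>l. M l \<subseteq> T l \<and>
          \<theta> * rho_sq e\<^sub>u e\<^sub>z (T l) (T l) \<le> rho_sq e\<^sub>u e\<^sub>z (T l) (M l) \<and>
          (\<forall>M'. M' \<subseteq> T l \<and> \<theta> * rho_sq e\<^sub>u e\<^sub>z (T l) (T l) \<le> rho_sq e\<^sub>u e\<^sub>z (T l) M' \<longrightarrow>
             real (card (M l)) \<le> C\<^sub>m\<^sub>a\<^sub>r\<^sub>k * real (card M')) \<and>
          T (Suc l) = refine (T l) (M l))"

definition linear_convergence ::
  "real \<Rightarrow> real \<Rightarrow> (nat \<Rightarrow> 'e mesh) \<Rightarrow> 'e estimator \<Rightarrow> 'e estimator \<Rightarrow> bool" where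
  "linear_convergence C\<^sub>l\<^sub>i\<^sub>n q\<^sub>l\<^sub>i\<^sub>n T e\<^sub>u e\<^sub>z \<longleftrightarrow>
     (\<forall>l n. total_est e\<^sub>u (T (l + n)) * total_est e\<^sub>z (T (l + n))
              \<le> C\<^sub>l\<^sub>i\<^sub>n * q\<^sub>l\<^sub>i\<^sub>n ^ n * (total_est e\<^sub>u (T l) * total_est e\<^sub>z (T l)))"


section \<open>Approximation classes\<close>

definition mesh_class ::
  "('e mesh \<Rightarrow> 'e mesh \<Rightarrow> 'e mesh) \<Rightarrow> 'e mesh \<Rightarrow> nat \<Rightarrow> 'e mesh set" where
  "mesh_class refine T0 N =
     {T \<in> refinements refine T0. real (card T) - real (card T0) \<le> real N}"

text \<open>The minimum is over a finite nonempty set if \<open>mesh_strategy\<close> and \<open>son_estimate\<close> hold.\<close>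
definition best_est ::
  "('e mesh \<Rightarrow> 'e mesh \<Rightarrow> 'e mesh) \<Rightarrow> 'e mesh \<Rightarrow> 'e estimator \<Rightarrow> nat \<Rightarrow> real" where
  "best_est refine T0 e N = Min (total_est e ` mesh_class refine T0 N)"

definition approx_norm ::
  "('e mesh \<Rightarrow> 'e mesh \<Rightarrow> 'e mesh) \<Rightarrow> 'e mesh \<Rightarrow> 'e estimator \<Rightarrow> real \<Rightarrow> ereal" where
  "approx_norm refine T0 e s =
     (SUP N::nat. ereal ((real N + 1) powr s * best_est refine T0 e N))"

definition max_rate ::
  "('e mesh \<Rightarrow> 'e mesh \<Rightarrow> 'e mesh) \<Rightarrow> 'e mesh \<Rightarrow> 'e estimator \<Rightarrow> ereal" where
  "max_rate refine T0 e = (SUP s \<in> {s. 0 < s \<and> approx_norm refine T0 e s < \<infinity>}. ereal s)"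

text \<open>
  No rate beyond \<open>max_rate\<close> is attained, not even along a subsequence of the \<open>N\<close>.  Note that
  \<open>approx_norm refine T0 e r = \<infinity>\<close> for all \<open>r > max_rate refine T0 e\<close> only yields
  that \<open>(N + 1) powr r * best_est refine T0 e N\<close> is unbounded, which gives no lower bound for
  \<open>best_est refine T0 e N\<close> that is valid for every \<open>N\<close>.
\<close>
definition sharp_max_rate ::
  "('e mesh \<Rightarrow> 'e mesh \<Rightarrow> 'e mesh) \<Rightarrow> 'e mesh \<Rightarrow> 'e estimator \<Rightarrow> bool" where
  "sharp_max_rate refine T0 e \<longleftrightarrow>
     (\<forall>r. max_rate refine T0 e < ereal r \<longrightarrow>
        (\<exists>c>0. \<forall>N::nat. c \<le> (real N + 1) powr r * best_est refine T0 e N))"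


section \<open>The standing assumptions\<close>

definition theta_star :: "real \<Rightarrow> real \<Rightarrow> real" where
  "theta_star C\<^sub>s\<^sub>t\<^sub>b C\<^sub>r\<^sub>e\<^sub>l = inverse (1 + C\<^sub>s\<^sub>t\<^sub>b\<^sup>2 * C\<^sub>r\<^sub>e\<^sub>l\<^sup>2)"

definition goal_adaptive_setting where
  "goal_adaptive_setting \<theta> C\<^sub>m\<^sub>a\<^sub>r\<^sub>k C\<^sub>m\<^sub>e\<^sub>s\<^sub>h C\<^sub>d\<^sub>i\<^sub>s\<^sub>t C\<^sub>s\<^sub>t\<^sub>b q\<^sub>r\<^sub>e\<^sub>d C\<^sub>r\<^sub>e\<^sub>d C\<^sub>o\<^sub>r\<^sub>t\<^sub>h C\<^sub>r\<^sub>e\<^sub>l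
       (refine :: 'e mesh \<Rightarrow> 'e mesh \<Rightarrow> 'e mesh) (T0 :: 'e mesh)
       (\<eta> :: label \<Rightarrow> 'e estimator) (d :: label \<Rightarrow> 'e distance)
       (T :: nat \<Rightarrow> 'e mesh) (M :: nat \<Rightarrow> 'e mesh) \<longleftrightarrow>
     mesh_strategy refine T0 \<and>
     son_estimate refine T0 \<and>
     closure_estimate C\<^sub>m\<^sub>e\<^sub>s\<^sub>h refine T0 \<and>
     overlay_estimate refine T0 \<and>
     (\<forall>w. nonneg_estimator refine T0 (\<eta> w) \<and>
          quasi_distance C\<^sub>d\<^sub>i\<^sub>s\<^sub>t refine T0 (d w) \<and>
          stability C\<^sub>s\<^sub>t\<^sub>b refine T0 (\<eta> w) (d w) \<and>
          reduction q\<^sub>r\<^sub>e\<^sub>d C\<^sub>r\<^sub>e\<^sub>d refine T0 (\<eta> w) (d w) \<and>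
          quasi_orthogonality C\<^sub>o\<^sub>r\<^sub>t\<^sub>h \<theta> T (\<eta> w) (d w) \<and>
          reliability C\<^sub>r\<^sub>e\<^sub>l refine T0 (\<eta> w) (d w)) \<and>
     goal_algorithm \<theta> C\<^sub>m\<^sub>a\<^sub>r\<^sub>k refine T0 (\<eta> Primal) (\<eta> Dual) T M"

end

theory Submission
  imports Defs
begin

text \<open>
  Write \<open>p l\<close> for the estimator product on the mesh \<open>T l\<close>. The rate of the product comes from
  bounding every marked set by a power of \<open>p\<close> and summing. Fix \<open>j\<close>. For each of the two
  estimators there is a mesh with about \<open>N\<close> additional elements that attains the best error; the
  overlay of both with \<open>T j\<close> has at most \<open>2 * N\<close> elements more than \<open>T j\<close>, and by
  quasi-monotonicity (\<open>quasi_monotone\<close>) its estimator product is at most of order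
  \<open>N powr -(s + t)\<close>. With \<open>N\<close> of order \<open>p j powr (- 1 / (s + t))\<close> this is a fixed small
  fraction of \<open>p j\<close>, hence at least one of the two estimators has dropped by a fixed factor.
  Stability and reliability then yield a set, not much larger than that of the elements refined by
  the overlay, which carries the fraction \<open>2 * \<theta>\<close> of that squared estimator (\<open>doerfler_optimality\<close>;
  this is where \<open>2 * \<theta> < theta_star\<close> enters), and so the fraction \<open>\<theta>\<close> of the combined quantity \<open>rho_sq\<close>, in
  which each estimator accounts for exactly one half. Since the algorithm marks an almost minimal
  set, it marks at most a constant times \<open>N\<close> elements (\<open>marked_card_le\<close>). By the closure
  estimate, the number of new elements up to step \<open>l\<close> is bounded by the sum of the
  \<open>p j powr (- 1 / (s + t))\<close> over \<open>j < l\<close>; linear convergence turns it into a geometric series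
  dominated by its last term (\<open>product_rate\<close>).

  The rates of the single estimators follow from that of the product: an estimator whose maximal
  rate is sharp cannot decay faster than slightly above this rate, so the other factor has to
  contribute the rest (\<open>factor_rate_of_product_rate\<close>). Linear convergence is no
  hypothesis there and has to be derived. Every step of the algorithm fulfils the
  Doerfler criterion for one of the two estimators. Along the steps which fulfil it for a given
  estimator, that estimator contracts up to a perturbation by the distance of consecutive meshes,
  which quasi-orthogonality makes summable; thus its squares, summed over these steps, are bounded
  by the first term (\<open>doerfler_steps_summable\<close>). Bounding the other factor by quasi-monotonicity
  gives the same for the squared products over all steps, and sequences with this property decay
  geometrically (\<open>linear_decay_of_summable_tails\<close>).
\<close>

section \<open>Meshes and approximation classes\<close>

lemma refinements_trans:
  assumes "T' \<in> refinements refine T" "T'' \<in> refinements refine T'"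
  shows "T'' \<in> refinements refine T"
  using assms(2,1) by (induction) (auto intro: refinements.intros)

locale mesh_refinement =
  fixes refine :: "'e mesh \<Rightarrow> 'e mesh \<Rightarrow> 'e mesh" and T0 :: "'e mesh"
  assumes strategy: "mesh_strategy refine T0"
    and sons: "son_estimate refine T0"
    and overlays: "overlay_estimate refine T0"
begin

abbreviation admissible :: "'e mesh set" where
  "admissible \<equiv> refinements refine T0"

lemma admissible_refinement:
  "T \<in> admissible \<Longrightarrow> T' \<in> refinements refine T \<Longrightarrow> T' \<in> admissible"
  by (rule refinements_trans)

lemma finite_mesh:
  assumes "T \<in> admissible"
  shows "finite T"
  using assms by cases (use strategy in \<open>auto simp: mesh_strategy_def\<close>)

lemma refined_elements_card:
  "T \<in> admissible \<Longrightarrow> T' \<in> refinements refine T \<Longrightarrow> card (T - T') + card T \<le> card T'"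
  using sons by (auto simp: son_estimate_def)

lemma card_initial_le: "T \<in> admissible \<Longrightarrow> card T0 \<le> card T"
  using refined_elements_card[of T0 T] refinements.refl[of T0 refine] by simp

lemma refined_element_stays_refined:
  assumes "T \<in> admissible" "T' \<in> refinements refine T" "T'' \<in> refinements refine T'"
  shows "T - T' \<subseteq> T - T''"
proof -
  have "T \<inter> T'' \<subseteq> T'"
    using strategy assms unfolding mesh_strategy_def by simp
  then show ?thesis
    by blast
qed

text \<open>
  The mesh \<open>T\<close> is itself a refinement of \<open>T\<close> in which all of the (no) marked elements are refined,
  so it refines \<open>refine T {}\<close>, the coarsest such mesh. Meshes that refine each other have no
  refined elements by the son estimate.
\<close>
lemma refine_empty:
  assumes "T \<in> admissible"
  shows "refine T {} = T"
proof -
  have step: "refine T {} \<in> refinements refine T"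
    by (rule refinements.step[OF refinements.refl]) simp
  have adm: "refine T {} \<in> admissible"
    using admissible_refinement[OF assms step] .
  have coarser: "T \<in> refinements refine (refine T {})"
    using strategy assms refinements.refl[of T refine]
    unfolding mesh_strategy_def by (metis empty_subsetI)
  have "card (T - refine T {}) = 0" "card (refine T {} - T) = 0"
    using refined_elements_card[OF assms step] refined_elements_card[OF adm coarser] by linarith+
  then show ?thesis
    using finite_mesh[OF assms] finite_mesh[OF adm] by auto
qed

lemma card_less_refine:
  assumes "T \<in> admissible" "M \<subseteq> T" "M \<noteq> {}"
  shows "card T < card (refine T M)"
proof -
  have step: "refine T M \<in> refinements refine T"
    by (rule refinements.step[OF refinements.refl assms(2)])
  have "M \<subseteq> T - refine T M"
    using strategy assms unfolding mesh_strategy_def by blast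
  then have "card (T - refine T M) \<noteq> 0"
    using assms finite_mesh[OF assms(1)] by auto
  then show ?thesis
    using refined_elements_card[OF assms(1) step] by linarith
qed

text \<open>
  Marking a nonempty set adds at least one element. Hence every mesh with at most \<open>N + 1\<close>
  additional elements arises by one step from a mesh with at most \<open>N\<close> of them, and each finite
  mesh has only finitely many marked sets.
\<close>
lemma finite_mesh_class: "finite (mesh_class refine T0 N)"
proof (induction N)
  case 0
  have "T = T0" if "T \<in> admissible" "card T \<le> card T0" for T
    using that
  proof (induction rule: refinements.induct)
    case (step T' M)
    show ?case
    proof (cases "M = {}")
      case False
      then show ?thesis
        using card_less_refine[OF step(1,2)] card_initial_le[OF step(1)] step by linarith
    qed (use step refine_empty in auto)
  qed simp
  then have "mesh_class refine T0 0 \<subseteq> {T0}"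
    by (auto simp: mesh_class_def)
  then show ?case
    using finite_subset by blast
next
  case (Suc N)
  define U where "U = insert T0 (\<Union>T\<in>mesh_class refine T0 N. refine T ` Pow T)"
  have "T \<in> U" if "T \<in> admissible" "card T \<le> card T0 + Suc N" for T
    using that
  proof (induction rule: refinements.induct)
    case (step T' M)
    show ?case
    proof (cases "M = {}")
      case False
      then have "T' \<in> mesh_class refine T0 N"
        using card_less_refine[OF step(1,2)] step by (auto simp: mesh_class_def)
      then show ?thesis
        using step(2) by (auto simp: U_def)
    qed (use step refine_empty in auto)
  qed (simp add: U_def)
  then have "mesh_class refine T0 (Suc N) \<subseteq> U"
    by (auto simp: mesh_class_def)
  moreover have "finite U"
    unfolding U_def using Suc finite_mesh by (auto simp: mesh_class_def)
  ultimately show ?case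
    using finite_subset by blast
qed

lemma initial_in_mesh_class: "T0 \<in> mesh_class refine T0 N"
  by (simp add: mesh_class_def refinements.refl)

lemma best_est_attained:
  obtains T where "T \<in> mesh_class refine T0 N" "total_est e T = best_est refine T0 e N"
proof -
  have "best_est refine T0 e N \<in> total_est e ` mesh_class refine T0 N"
    unfolding best_est_def using finite_mesh_class initial_in_mesh_class
    by (intro Min_in) auto
  then show ?thesis
    using that by auto
qed

lemma best_est_le:
  "T \<in> mesh_class refine T0 N \<Longrightarrow> best_est refine T0 e N \<le> total_est e T"
  unfolding best_est_def using finite_mesh_class by simp

lemma best_est_nonneg: "0 \<le> best_est refine T0 e N"
  by (metis best_est_attained est_def real_sqrt_ge_zero sum_nonneg zero_le_power2)

lemma approx_norm_finite:
  assumes "approx_norm refine T0 e s < \<infinity>"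
  obtains A where "0 \<le> A" "approx_norm refine T0 e s = ereal A"
    "\<And>N. best_est refine T0 e N \<le> A * (real N + 1) powr - s"
proof -
  have le: "ereal ((real N + 1) powr s * best_est refine T0 e N) \<le> approx_norm refine T0 e s" for N
    unfolding approx_norm_def by (rule SUP_upper) simp
  have "0 \<le> approx_norm refine T0 e s"
    using le[of 0] best_est_nonneg[of e 0] by (metis (no_types, lifting) ereal_less_eq(5) mult_nonneg_nonneg order_trans powr_ge_zero)
  with assms obtain A where A: "approx_norm refine T0 e s = ereal A" "0 \<le> A"
    by (cases "approx_norm refine T0 e s") auto
  have "best_est refine T0 e N \<le> A * (real N + 1) powr - s" for N
    using le[of N] A(1) by (simp add: powr_minus field_simps)
  then show ?thesis
    using that A by blast
qed

lemma overlay_three: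
  assumes "T \<in> admissible" "T1 \<in> mesh_class refine T0 N" "T2 \<in> mesh_class refine T0 N"
  obtains T' where "T' \<in> refinements refine T" "T' \<in> refinements refine T1"
    "T' \<in> refinements refine T2" "real (card T') \<le> real (card T) + 2 * real N"
proof -
  have adm: "T1 \<in> admissible" "T2 \<in> admissible"
    using assms by (auto simp: mesh_class_def)
  obtain T3 where T3: "T3 \<in> refinements refine T" "T3 \<in> refinements refine T1"
      "real (card T3) \<le> real (card T) + real (card T1) - real (card T0)"
    using overlays assms(1) adm unfolding overlay_estimate_def by blast
  have "T3 \<in> admissible"
    using T3(1) assms(1) admissible_refinement by blast
  then obtain T' where T': "T' \<in> refinements refine T3" "T' \<in> refinements refine T2"
      "real (card T') \<le> real (card T3) + real (card T2) - real (card T0)"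
    using overlays adm unfolding overlay_estimate_def by blast
  show ?thesis
  proof (rule that)
    show "T' \<in> refinements refine T" "T' \<in> refinements refine T1"
      using T3 T'(1) refinements_trans by blast+
    show "real (card T') \<le> real (card T) + 2 * real N"
      using T3(3) T'(3) assms by (simp add: mesh_class_def)
  qed (rule T'(2))
qed

end

section \<open>Consequences of the axioms for a single estimator\<close>

lemma est_nonneg: "0 \<le> est e T U"
  by (simp add: est_def sum_nonneg)

lemma est_sq: "(est e T U)\<^sup>2 = (\<Sum>K\<in>U. (e T K)\<^sup>2)"
  by (simp add: est_def sum_nonneg)

lemma est_sq_mono: "finite V \<Longrightarrow> U \<subseteq> V \<Longrightarrow> (est e T U)\<^sup>2 \<le> (est e T V)\<^sup>2"
  unfolding est_sq by (rule sum_mono2) auto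

lemma est_sq_split:
  "finite T \<Longrightarrow> (est e X T)\<^sup>2 = (est e X (T \<inter> T'))\<^sup>2 + (est e X (T - T'))\<^sup>2"
  unfolding est_sq by (simp add: sum.Int_Diff)

lemma young_sq:
  fixes a b c \<delta> :: real
  assumes "0 < \<delta>" "0 \<le> a" "\<bar>a - b\<bar> \<le> c"
  shows "a\<^sup>2 \<le> (1 + \<delta>) * b\<^sup>2 + (1 + 1 / \<delta>) * c\<^sup>2"
proof -
  have "a\<^sup>2 \<le> (\<bar>b\<bar> + c)\<^sup>2"
    using assms by (intro power_mono) auto
  also have "\<dots> = b\<^sup>2 + c\<^sup>2 + 2 * \<bar>b\<bar> * c"
    by (simp add: power2_sum)
  also have "2 * \<bar>b\<bar> * c \<le> \<delta> * b\<^sup>2 + c\<^sup>2 / \<delta>"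
  proof -
    have "0 \<le> (\<delta> * \<bar>b\<bar> - c)\<^sup>2 / \<delta>"
      using assms by simp
    also have "\<dots> = \<delta> * b\<^sup>2 + c\<^sup>2 / \<delta> - 2 * \<bar>b\<bar> * c"
      using assms by (simp add: power2_diff field_simps power2_eq_square)
    finally show ?thesis by simp
  qed
  finally show ?thesis
    by (simp add: field_simps)
qed

text \<open>
  The factor of the squared distance when the stability bound on the unrefined elements, squared by
  Young's inequality with parameter \<open>\<delta>\<close>, is added to the reduction bound on the refined ones; the
  second summand reverses the arguments of the distance.
\<close>
definition perturbation_const :: "real \<Rightarrow> real \<Rightarrow> real \<Rightarrow> real \<Rightarrow> real" where
  "perturbation_const C\<^sub>s\<^sub>t\<^sub>b C\<^sub>r\<^sub>e\<^sub>d C\<^sub>d\<^sub>i\<^sub>s\<^sub>t \<delta> = (1 + 1 / \<delta>) * C\<^sub>s\<^sub>t\<^sub>b\<^sup>2 + C\<^sub>r\<^sub>e\<^sub>d * C\<^sub>d\<^sub>i\<^sub>s\<^sub>t\<^sup>2"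

definition monotonicity_const :: "real \<Rightarrow> real \<Rightarrow> real \<Rightarrow> real \<Rightarrow> real" where
  "monotonicity_const C\<^sub>s\<^sub>t\<^sub>b C\<^sub>r\<^sub>e\<^sub>d C\<^sub>d\<^sub>i\<^sub>s\<^sub>t C\<^sub>r\<^sub>e\<^sub>l =
     2 + perturbation_const C\<^sub>s\<^sub>t\<^sub>b C\<^sub>r\<^sub>e\<^sub>d C\<^sub>d\<^sub>i\<^sub>s\<^sub>t 1 * C\<^sub>r\<^sub>e\<^sub>l\<^sup>2"

lemma perturbation_const_pos:
  "0 < C\<^sub>s\<^sub>t\<^sub>b \<Longrightarrow> 0 < C\<^sub>r\<^sub>e\<^sub>d \<Longrightarrow> 0 < \<delta> \<Longrightarrow> 0 < perturbation_const C\<^sub>s\<^sub>t\<^sub>b C\<^sub>r\<^sub>e\<^sub>d C\<^sub>d\<^sub>i\<^sub>s\<^sub>t \<delta>"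
  unfolding perturbation_const_def by (intro add_pos_nonneg mult_pos_pos) auto

lemma monotonicity_const_ge_1:
  "0 < C\<^sub>s\<^sub>t\<^sub>b \<Longrightarrow> 0 < C\<^sub>r\<^sub>e\<^sub>d \<Longrightarrow> 1 \<le> monotonicity_const C\<^sub>s\<^sub>t\<^sub>b C\<^sub>r\<^sub>e\<^sub>d C\<^sub>d\<^sub>i\<^sub>s\<^sub>t C\<^sub>r\<^sub>e\<^sub>l"
  using perturbation_const_pos[of C\<^sub>s\<^sub>t\<^sub>b C\<^sub>r\<^sub>e\<^sub>d 1 C\<^sub>d\<^sub>i\<^sub>s\<^sub>t]
    mult_nonneg_nonneg[of "perturbation_const C\<^sub>s\<^sub>t\<^sub>b C\<^sub>r\<^sub>e\<^sub>d C\<^sub>d\<^sub>i\<^sub>s\<^sub>t 1" "C\<^sub>r\<^sub>e\<^sub>l\<^sup>2"]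
  unfolding monotonicity_const_def by simp

text \<open>
  Summing the contraction bounds the shifted sum by \<open>1 - 2 * \<delta>\<close> times the original sum plus the
  perturbations. Quasi-orthogonality replaces these by a multiple of the first term and a further
  \<open>C * \<epsilon> \<le> \<delta>\<close> times the sum; since the remaining factor \<open>1 - \<delta>\<close> is less than one, the sum can
  be absorbed.
\<close>
lemma sum_bound_of_perturbed_contraction:
  fixes E D :: "nat \<Rightarrow> real"
  assumes nonneg: "\<And>j. 0 \<le> E j" and "n \<le> N" "0 < \<delta>" "\<delta> \<le> 1" "0 \<le> C" "0 \<le> B" "C * \<epsilon> \<le> \<delta>"
    and contr: "\<And>j. n \<le> j \<Longrightarrow> j \<le> N \<Longrightarrow> E (Suc j) \<le> (1 - 2 * \<delta>) * E j + C * D j"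
    and orth: "(\<Sum>j=n..N. D j - \<epsilon> * E j) \<le> B * E n"
  shows "(\<Sum>j=n..Suc N. E j) \<le> (1 + C * B) * (1 + 1 / \<delta>) * E n"
proof -
  define X where "X = (\<Sum>j=n..N. E j)"
  define Y where "Y = (\<Sum>j=n..N. E (Suc j))"
  have X0: "0 \<le> X"
    unfolding X_def by (simp add: nonneg sum_nonneg)
  have Y_eq: "(\<Sum>j=n..Suc N. E j) = E n + Y"
    unfolding Y_def using assms(2)
    by (simp only: sum.shift_bounds_cl_Suc_ivl[symmetric] sum.atLeast_Suc_atMost)
  have XY: "X \<le> E n + Y"
    using Y_eq assms(2) nonneg[of "Suc N"] unfolding X_def by simp
  have "Y \<le> (\<Sum>j=n..N. (1 - 2 * \<delta>) * E j + C * D j)"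
    unfolding Y_def using contr by (intro sum_mono) auto
  also have "\<dots> = (1 - 2 * \<delta>) * X + C * (\<Sum>j=n..N. D j - \<epsilon> * E j) + C * \<epsilon> * X"
    unfolding X_def by (simp add: sum.distrib sum_subtractf sum_distrib_left algebra_simps)
  also have "\<dots> \<le> (1 - 2 * \<delta>) * X + C * (B * E n) + \<delta> * X"
    using orth assms X0 by (intro add_mono mult_left_mono mult_right_mono) auto
  finally have Y: "Y \<le> (1 - \<delta>) * X + C * B * E n"
    by (simp add: algebra_simps)
  have "\<delta> * X \<le> (1 + C * B) * E n"
    using Y XY by (simp add: algebra_simps)
  then have X: "X \<le> (1 + C * B) * E n / \<delta>"
    using assms by (simp add: field_simps)
  have "(1 - \<delta>) * X \<le> X"
    using X0 assms by (simp add: algebra_simps)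
  then have "E n + Y \<le> E n + X + C * B * E n"
    using Y by simp
  also have "\<dots> \<le> (1 + C * B) * (1 + 1 / \<delta>) * E n"
    using X by (simp add: algebra_simps add_divide_distrib)
  finally show ?thesis
    using Y_eq by simp
qed

lemma enumerate_mem:
  "infinite D \<or> j < card D \<Longrightarrow> enumerate D j \<in> D" for D :: "nat set"
  using enumerate_in_set finite_enumerate_in_set by blast

lemma enumerate_less:
  "infinite D \<or> k < card D \<Longrightarrow> j < k \<Longrightarrow> enumerate D j < enumerate D k" for D :: "nat set"
  using enumerate_mono finite_enumerate_mono by blast

lemma enumerate_surj:
  "l \<in> D \<Longrightarrow> \<exists>j. (infinite D \<or> j < card D) \<and> enumerate D j = l" for D :: "nat set"
  using enumerate_Ex finite_enumerate_Ex by metis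

text \<open>
  Quasi-orthogonality speaks of positions in the enumeration of \<open>D\<close>, whereas linear convergence
  needs sums over an arbitrary window of step numbers, whose first index \<open>m\<close> need not lie in \<open>D\<close>.
  The growth bound compares the first member of \<open>D\<close> in the window with \<open>m\<close>.
\<close>
lemma sum_le_of_enumerated_sums:
  fixes f :: "nat \<Rightarrow> real" and D :: "nat set"
  assumes nonneg: "\<And>l. 0 \<le> f l"
    and tails: "\<And>n N. n \<le> N \<Longrightarrow> infinite D \<or> N < card D \<Longrightarrow>
      (\<Sum>j=n..N. f (enumerate D j)) \<le> C * f (enumerate D n)"
    and growth: "\<And>k. m \<le> k \<Longrightarrow> f k \<le> K * f m"
    and "0 \<le> C" "0 \<le> K"
  shows "(\<Sum>l\<in>D \<inter> {m..L}. f l) \<le> C * K * f m"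
proof (cases "D \<inter> {m..L} = {}")
  case True
  then show ?thesis
    using assms by simp
next
  case False
  obtain g where g: "\<And>l. l \<in> D \<Longrightarrow> (infinite D \<or> g l < card D) \<and> enumerate D (g l) = l"
    using bchoice[of D "\<lambda>l j. (infinite D \<or> j < card D) \<and> enumerate D j = l"] enumerate_surj by blast
  define J where "J = g ` (D \<inter> {m..L})"
  have J: "finite J" "J \<noteq> {}"
    using False by (auto simp: J_def)
  have img: "enumerate D ` J = D \<inter> {m..L}"
    using g by (force simp: J_def)
  have valid: "infinite D \<or> j < card D" "m \<le> enumerate D j" if "j \<in> J" for j
    using that g by (auto simp: J_def)
  have "(\<Sum>l\<in>D \<inter> {m..L}. f l) \<le> (\<Sum>j\<in>J. f (enumerate D j))"
    unfolding img[symmetric]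
    using sum_image_le[OF J(1), of f "enumerate D"] nonneg by (simp add: o_def)
  also have "\<dots> \<le> (\<Sum>j=Min J..Max J. f (enumerate D j))"
    using J nonneg by (intro sum_mono2) auto
  also have "\<dots> \<le> C * f (enumerate D (Min J))"
    using J valid by (intro tails) auto
  also have "\<dots> \<le> C * (K * f m)"
    using growth[OF valid(2)[OF Min_in[OF J]]] assms by (intro mult_left_mono) auto
  finally show ?thesis
    by (simp add: mult.assoc)
qed

text \<open>
  The slack between \<open>\<theta>\<close> and the threshold \<open>inverse (1 + G)\<close> is split evenly between a Young
  parameter \<open>\<delta>\<close> and a reduction factor \<open>\<kappa>\<close>, chosen in this order and depending on \<open>\<theta>\<close> and \<open>G\<close> only,
  as the uniformity of the final constant requires.
\<close>
lemma doerfler_parameters_exist: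
  fixes \<theta> G :: real
  assumes "\<theta> < inverse (1 + G)" "0 < \<theta>" "0 \<le> G"
  obtains \<delta> \<kappa> where "0 < \<delta>" "0 < \<kappa>" "\<theta> * (1 + (1 + \<delta>) * G) \<le> 1 - (1 + 1 / \<delta>) * \<kappa>"
proof -
  define g where "g = 1 - \<theta> * (1 + G)"
  have g: "0 < g"
    using assms unfolding g_def by (simp add: field_simps)
  define \<delta> where "\<delta> = g / (2 * (\<theta> * (G + 1)))"
  define \<kappa> where "\<kappa> = g / (2 * (1 + 1 / \<delta>))"
  have d: "0 < \<delta>"
    using g assms by (simp add: \<delta>_def)
  then have k: "0 < \<kappa>"
    using g by (simp add: \<kappa>_def add_pos_pos)
  have "\<theta> * (\<delta> * G) \<le> \<delta> * (\<theta> * (G + 1))"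
    using d assms by (simp add: algebra_simps)
  also have "\<dots> = g / 2"
  proof -
    have "\<theta> * (G + 1) \<noteq> 0"
      using assms by simp
    then show ?thesis
      unfolding \<delta>_def by (simp only: divide_simps) simp
  qed
  finally have 1: "\<theta> * (\<delta> * G) \<le> g / 2" .
  have "1 + 1 / \<delta> > 0"
    using d by (simp add: add_pos_pos)
  then have 2: "(1 + 1 / \<delta>) * \<kappa> = g / 2"
    unfolding \<kappa>_def by (simp only: divide_simps) simp
  have "\<theta> * (1 + (1 + \<delta>) * G) \<le> 1 - (1 + 1 / \<delta>) * \<kappa>"
    unfolding 2 using 1 g_def by (simp add: algebra_simps)
  then show ?thesis
    using that d k by blast
qed

locale estimator_axioms = mesh_refinement refine T0
  for refine :: "'e mesh \<Rightarrow> 'e mesh \<Rightarrow> 'e mesh" and T0 :: "'e mesh" +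
  fixes C\<^sub>d\<^sub>i\<^sub>s\<^sub>t C\<^sub>s\<^sub>t\<^sub>b q\<^sub>r\<^sub>e\<^sub>d C\<^sub>r\<^sub>e\<^sub>d C\<^sub>r\<^sub>e\<^sub>l :: real and e :: "'e estimator" and d :: "'e distance"
  assumes constants: "0 < C\<^sub>s\<^sub>t\<^sub>b" "q\<^sub>r\<^sub>e\<^sub>d < 1" "0 < C\<^sub>r\<^sub>e\<^sub>d" "0 < C\<^sub>r\<^sub>e\<^sub>l"
    and dist: "quasi_distance C\<^sub>d\<^sub>i\<^sub>s\<^sub>t refine T0 d"
    and stab: "stability C\<^sub>s\<^sub>t\<^sub>b refine T0 e d"
    and red: "reduction q\<^sub>r\<^sub>e\<^sub>d C\<^sub>r\<^sub>e\<^sub>d refine T0 e d"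
    and rel: "reliability C\<^sub>r\<^sub>e\<^sub>l refine T0 e d"
begin

abbreviation perturbation :: "real \<Rightarrow> real" where
  "perturbation \<equiv> perturbation_const C\<^sub>s\<^sub>t\<^sub>b C\<^sub>r\<^sub>e\<^sub>d C\<^sub>d\<^sub>i\<^sub>s\<^sub>t"

abbreviation C\<^sub>m\<^sub>o\<^sub>n :: real where
  "C\<^sub>m\<^sub>o\<^sub>n \<equiv> monotonicity_const C\<^sub>s\<^sub>t\<^sub>b C\<^sub>r\<^sub>e\<^sub>d C\<^sub>d\<^sub>i\<^sub>s\<^sub>t C\<^sub>r\<^sub>e\<^sub>l"

lemma estimator_perturbation:
  assumes "T \<in> admissible" "T' \<in> refinements refine T" "0 < \<delta>"
  shows "(total_est e T')\<^sup>2 \<le> (1 + \<delta>) * (est e T (T \<inter> T'))\<^sup>2 + q\<^sub>r\<^sub>e\<^sub>d * (est e T (T - T'))\<^sup>2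
           + perturbation \<delta> * (d T' T)\<^sup>2"
proof -
  have adm: "T' \<in> admissible"
    using assms admissible_refinement by blast
  have split: "(total_est e T')\<^sup>2 = (est e T' (T \<inter> T'))\<^sup>2 + (est e T' (T' - T))\<^sup>2"
    using est_sq_split[OF finite_mesh[OF adm], of e T' T] by (simp add: Int_commute)
  have "\<bar>est e T' (T \<inter> T') - est e T (T \<inter> T')\<bar> \<le> C\<^sub>s\<^sub>t\<^sub>b * d T' T"
    using stab assms unfolding stability_def by blast
  from young_sq[OF assms(3) est_nonneg this]
  have kept: "(est e T' (T \<inter> T'))\<^sup>2 \<le>
      (1 + \<delta>) * (est e T (T \<inter> T'))\<^sup>2 + (1 + 1 / \<delta>) * C\<^sub>s\<^sub>t\<^sub>b\<^sup>2 * (d T' T)\<^sup>2"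
    by (simp add: power_mult_distrib mult.assoc)
  have "0 \<le> d T T'" "d T T' \<le> C\<^sub>d\<^sub>i\<^sub>s\<^sub>t * d T' T"
    using dist assms adm unfolding quasi_distance_def by blast+
  then have "(d T T')\<^sup>2 \<le> C\<^sub>d\<^sub>i\<^sub>s\<^sub>t\<^sup>2 * (d T' T)\<^sup>2"
    by (metis power_mono power_mult_distrib)
  then have "C\<^sub>r\<^sub>e\<^sub>d * (d T T')\<^sup>2 \<le> C\<^sub>r\<^sub>e\<^sub>d * C\<^sub>d\<^sub>i\<^sub>s\<^sub>t\<^sup>2 * (d T' T)\<^sup>2"
    using constants by (simp add: mult.assoc)
  moreover have "(est e T' (T' - T))\<^sup>2 \<le> q\<^sub>r\<^sub>e\<^sub>d * (est e T (T - T'))\<^sup>2 + C\<^sub>r\<^sub>e\<^sub>d * (d T T')\<^sup>2"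
    using red assms unfolding reduction_def by blast
  ultimately show ?thesis
    unfolding split perturbation_const_def using kept by (simp add: algebra_simps)
qed

lemma reliability_total:
  assumes "T \<in> admissible" "T' \<in> refinements refine T"
  shows "(d T' T)\<^sup>2 \<le> C\<^sub>r\<^sub>e\<^sub>l\<^sup>2 * (total_est e T)\<^sup>2"
proof -
  obtain R where R: "R \<subseteq> T" "d T' T \<le> C\<^sub>r\<^sub>e\<^sub>l * est e T R"
    using rel[unfolded reliability_def, rule_format, OF assms] by blast
  have "0 \<le> d T' T"
    using dist assms(1) admissible_refinement[OF assms] unfolding quasi_distance_def by blast
  then have "(d T' T)\<^sup>2 \<le> C\<^sub>r\<^sub>e\<^sub>l\<^sup>2 * (est e T R)\<^sup>2"
    using R by (metis power_mono power_mult_distrib)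
  also have "\<dots> \<le> C\<^sub>r\<^sub>e\<^sub>l\<^sup>2 * (total_est e T)\<^sup>2"
    using R assms finite_mesh by (intro mult_left_mono est_sq_mono) auto
  finally show ?thesis .
qed

lemma quasi_monotone:
  assumes "T \<in> admissible" "T' \<in> refinements refine T"
  shows "(total_est e T')\<^sup>2 \<le> C\<^sub>m\<^sub>o\<^sub>n * (total_est e T)\<^sup>2"
proof -
  have "(total_est e T')\<^sup>2 \<le> 2 * (est e T (T \<inter> T'))\<^sup>2 + q\<^sub>r\<^sub>e\<^sub>d * (est e T (T - T'))\<^sup>2
           + perturbation 1 * (d T' T)\<^sup>2"
    using estimator_perturbation[OF assms, of 1] by simp
  also have "\<dots> \<le> 2 * (est e T (T \<inter> T'))\<^sup>2 + 2 * (est e T (T - T'))\<^sup>2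
           + perturbation 1 * (C\<^sub>r\<^sub>e\<^sub>l\<^sup>2 * (total_est e T)\<^sup>2)"
    using constants perturbation_const_pos[of C\<^sub>s\<^sub>t\<^sub>b C\<^sub>r\<^sub>e\<^sub>d 1 C\<^sub>d\<^sub>i\<^sub>s\<^sub>t] reliability_total[OF assms]
    by (intro add_mono mult_left_mono mult_right_mono) auto
  also have "\<dots> = C\<^sub>m\<^sub>o\<^sub>n * (total_est e T)\<^sup>2"
    using est_sq_split[OF finite_mesh[OF assms(1)], of e T T']
    by (simp add: monotonicity_const_def algebra_simps)
  finally show ?thesis .
qed

text \<open>
  The refined elements contribute with the factor \<open>q\<^sub>r\<^sub>e\<^sub>d < 1\<close> instead of one, which gains
  \<open>(1 - q\<^sub>r\<^sub>e\<^sub>d) * \<theta>\<close> once they carry the fraction \<open>\<theta>\<close> of the squared estimator.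
\<close>
lemma estimator_reduction:
  assumes "T \<in> admissible" "T' \<in> refinements refine T" "0 < \<delta>"
    and marked: "\<theta> * (total_est e T)\<^sup>2 \<le> (est e T (T - T'))\<^sup>2"
  shows "(total_est e T')\<^sup>2 \<le> (1 + \<delta> - (1 - q\<^sub>r\<^sub>e\<^sub>d) * \<theta>) * (total_est e T)\<^sup>2 + perturbation \<delta> * (d T' T)\<^sup>2"
proof -
  define a where "a = (total_est e T)\<^sup>2"
  define b where "b = (est e T (T - T'))\<^sup>2"
  have split: "(est e T (T \<inter> T'))\<^sup>2 = a - b"
    using est_sq_split[OF finite_mesh[OF assms(1)], of e T T'] by (simp add: a_def b_def)
  have "(1 - q\<^sub>r\<^sub>e\<^sub>d) * (\<theta> * a) \<le> (1 - q\<^sub>r\<^sub>e\<^sub>d) * b"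
    using marked constants unfolding a_def b_def by (intro mult_left_mono) auto
  moreover have "0 \<le> \<delta> * b"
    using assms by (simp add: b_def)
  ultimately have "(1 + \<delta>) * (a - b) + q\<^sub>r\<^sub>e\<^sub>d * b \<le> (1 + \<delta> - (1 - q\<^sub>r\<^sub>e\<^sub>d) * \<theta>) * a"
    by (simp add: algebra_simps)
  then show ?thesis
    using estimator_perturbation[OF assms(1-3)] unfolding split a_def[symmetric] b_def[symmetric]
    by linarith
qed

text \<open>
  On the unrefined elements the estimator differs from its value on the finer mesh, which is small
  by assumption, by at most \<open>C\<^sub>s\<^sub>t\<^sub>b\<close> times the distance, and by reliability the distance is
  controlled by the estimator on \<open>R\<close>. So the whole estimator on \<open>T\<close> is, up to a fraction of itself,
  controlled by its part on \<open>R\<close>.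
\<close>
lemma doerfler_optimality:
  assumes "T \<in> admissible" "T' \<in> refinements refine T" "0 < \<delta>" "0 < \<kappa>"
    and param: "\<theta> * (1 + (1 + \<delta>) * (C\<^sub>s\<^sub>t\<^sub>b\<^sup>2 * C\<^sub>r\<^sub>e\<^sub>l\<^sup>2)) \<le> 1 - (1 + 1 / \<delta>) * \<kappa>"
    and better: "(total_est e T')\<^sup>2 \<le> \<kappa> * (total_est e T)\<^sup>2"
  obtains R where "R \<subseteq> T" "real (card R) \<le> C\<^sub>r\<^sub>e\<^sub>l * real (card (T - T'))"
    "\<theta> * (total_est e T)\<^sup>2 \<le> (est e T R)\<^sup>2"
proof -
  obtain R where R: "T - T' \<subseteq> R" "R \<subseteq> T" "real (card R) \<le> C\<^sub>r\<^sub>e\<^sub>l * real (card (T - T'))"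
      "d T' T \<le> C\<^sub>r\<^sub>e\<^sub>l * est e T R"
    using rel[unfolded reliability_def, rule_format, OF assms(1,2)] by blast
  have adm: "T' \<in> admissible" and fin: "finite T" "finite T'"
    using assms admissible_refinement finite_mesh by blast+
  define g where "g = 1 + (1 + \<delta>) * (C\<^sub>s\<^sub>t\<^sub>b\<^sup>2 * C\<^sub>r\<^sub>e\<^sub>l\<^sup>2)"
  have g: "0 < g"
    using assms by (auto simp: g_def intro!: add_pos_nonneg)
  have "C\<^sub>s\<^sub>t\<^sub>b * d T' T \<le> C\<^sub>s\<^sub>t\<^sub>b * (C\<^sub>r\<^sub>e\<^sub>l * est e T R)"
    using R(4) constants by (intro mult_left_mono) auto
  then have "\<bar>est e T (T \<inter> T') - est e T' (T \<inter> T')\<bar> \<le> C\<^sub>s\<^sub>t\<^sub>b * (C\<^sub>r\<^sub>e\<^sub>l * est e T R)"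
    using stab assms(1,2) unfolding stability_def by (smt (verit))
  from young_sq[of "1 / \<delta>", OF _ est_nonneg this]
  have kept: "(est e T (T \<inter> T'))\<^sup>2 \<le> (1 + 1 / \<delta>) * (est e T' (T \<inter> T'))\<^sup>2
      + (1 + \<delta>) * (C\<^sub>s\<^sub>t\<^sub>b\<^sup>2 * C\<^sub>r\<^sub>e\<^sub>l\<^sup>2) * (est e T R)\<^sup>2"
    using assms(3) by (simp add: power_mult_distrib mult.assoc)
  have "(est e T' (T \<inter> T'))\<^sup>2 \<le> \<kappa> * (total_est e T)\<^sup>2"
    using est_sq_mono[OF fin(2), of "T \<inter> T'" e T'] better by auto
  then have "(1 + 1 / \<delta>) * (est e T' (T \<inter> T'))\<^sup>2 \<le> (1 + 1 / \<delta>) * (\<kappa> * (total_est e T)\<^sup>2)"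
    using assms(3) by (intro mult_left_mono) auto
  moreover have "(est e T (T - T'))\<^sup>2 \<le> (est e T R)\<^sup>2"
    using R fin finite_subset by (intro est_sq_mono) blast+
  moreover have "(total_est e T)\<^sup>2 = (est e T (T \<inter> T'))\<^sup>2 + (est e T (T - T'))\<^sup>2"
    by (rule est_sq_split[OF fin(1)])
  ultimately have "(1 - (1 + 1 / \<delta>) * \<kappa>) * (total_est e T)\<^sup>2 \<le> g * (est e T R)\<^sup>2"
    using kept unfolding g_def by (simp add: algebra_simps)
  moreover have "\<theta> * g * (total_est e T)\<^sup>2 \<le> (1 - (1 + 1 / \<delta>) * \<kappa>) * (total_est e T)\<^sup>2"
    using param unfolding g_def by (intro mult_right_mono) auto
  ultimately have "g * (\<theta> * (total_est e T)\<^sup>2) \<le> g * (est e T R)\<^sup>2"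
    by (simp add: mult_ac)
  then have "\<theta> * (total_est e T)\<^sup>2 \<le> (est e T R)\<^sup>2"
    using g by simp
  then show ?thesis
    using that R by blast
qed

text \<open>
  Between two consecutive steps \<open>l < k\<close> of the subsequence the meshes may be refined further, but an
  element refined in step \<open>l\<close> remains refined. The criterion thus holds for the pair \<open>T l\<close>, \<open>T k\<close>,
  and the estimator contracts along the subsequence.
\<close>
lemma doerfler_steps_summable:
  fixes T :: "nat \<Rightarrow> 'e mesh"
  assumes seq: "\<And>l. T l \<in> admissible" "\<And>l k. l \<le> k \<Longrightarrow> T k \<in> refinements refine (T l)"
    and orth: "quasi_orthogonality C\<^sub>o\<^sub>r\<^sub>t\<^sub>h \<theta> T e d"
    and Corth_pos: "\<And>\<epsilon>. \<epsilon> > 0 \<Longrightarrow> C\<^sub>o\<^sub>r\<^sub>t\<^sub>h \<epsilon> > 0"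
    and \<theta>: "0 < \<theta>" "\<theta> \<le> 1" and q0: "0 < q\<^sub>r\<^sub>e\<^sub>d"
  obtains C where "0 < C"
    "\<And>m L. (\<Sum>l\<in>doerfler_steps \<theta> e T \<inter> {m..L}. (total_est e (T l))\<^sup>2) \<le> C * (total_est e (T m))\<^sup>2"
proof -
  define D where "D = doerfler_steps \<theta> e T"
  \<comment> \<open>One third of the gain is spent on Young's inequality and one third on quasi-orthogonality.\<close>
  define \<delta> where "\<delta> = (1 - q\<^sub>r\<^sub>e\<^sub>d) * \<theta> / 3"
  define Ce where "Ce = perturbation \<delta>"
  define \<epsilon> where "\<epsilon> = \<delta> / Ce"
  define C where "C = (1 + Ce * C\<^sub>o\<^sub>r\<^sub>t\<^sub>h \<epsilon>) * (1 + 1 / \<delta>)"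
  have \<delta>: "0 < \<delta>" "\<delta> \<le> 1"
    using constants \<theta> q0 mult_le_one[of "1 - q\<^sub>r\<^sub>e\<^sub>d" \<theta>] by (auto simp: \<delta>_def)
  have Ce: "0 < Ce"
    using perturbation_const_pos constants \<delta> by (simp add: Ce_def)
  have \<epsilon>: "0 < \<epsilon>"
    using \<delta> Ce by (simp add: \<epsilon>_def)
  have Co: "0 < Ce * C\<^sub>o\<^sub>r\<^sub>t\<^sub>h \<epsilon>"
    using Ce Corth_pos[OF \<epsilon>] by simp
  have C: "1 \<le> C"
    unfolding C_def using Co \<delta> mult_mono[of 1 "1 + Ce * C\<^sub>o\<^sub>r\<^sub>t\<^sub>h \<epsilon>" 1 "1 + 1 / \<delta>"] by simp
  have Cmon: "1 \<le> C\<^sub>m\<^sub>o\<^sub>n"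
    using monotonicity_const_ge_1 constants by blast
  define S where "S = (\<lambda>j. T (enumerate D j))"
  define E where "E = (\<lambda>j. (total_est e (S j))\<^sup>2)"
  have contr: "E (Suc j) \<le> (1 - 2 * \<delta>) * E j + Ce * (d (S (Suc j)) (S j))\<^sup>2"
    if "infinite D \<or> Suc j < card D" for j
  proof -
    define l where "l = enumerate D j"
    define k where "k = enumerate D (Suc j)"
    have l: "l \<in> D" and lk: "Suc l \<le> k"
      using that enumerate_mem[of D j] enumerate_less[OF that lessI] by (auto simp: l_def k_def)
    have "T l - T (Suc l) \<subseteq> T l - T k"
      using seq lk by (intro refined_element_stays_refined) auto
    then have "(est e (T l) (T l - T (Suc l)))\<^sup>2 \<le> (est e (T l) (T l - T k))\<^sup>2"
      using finite_mesh[OF seq(1)] by (intro est_sq_mono) auto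
    then have "\<theta> * (total_est e (T l))\<^sup>2 \<le> (est e (T l) (T l - T k))\<^sup>2"
      using l by (simp add: D_def doerfler_steps_def)
    from estimator_reduction[OF seq(1) seq(2) \<delta>(1) this] lk
    have "(total_est e (T k))\<^sup>2 \<le>
        (1 + \<delta> - 3 * \<delta>) * (total_est e (T l))\<^sup>2 + Ce * (d (T k) (T l))\<^sup>2"
      by (simp add: Ce_def \<delta>_def)
    then show ?thesis
      by (simp add: E_def S_def l_def k_def)
  qed
  have tails: "(\<Sum>j=n..N. E j) \<le> C * E n" if "n \<le> N" "infinite D \<or> N < card D" for n N
  proof (cases "n = N")
    \<comment> \<open>Quasi-orthogonality needs a successor of its last index, so it covers only \<open>n < N\<close>, with upper
      index \<open>N - 1\<close>.\<close>
    case True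
    then show ?thesis
      using mult_right_mono[OF C, of "E n"] by (simp add: E_def)
  next
    case False
    define N' where "N' = N - 1"
    have N': "N = Suc N'" "n \<le> N'"
      using False that(1) by (auto simp: N'_def)
    have "(\<Sum>j=n..N'. (d (S (Suc j)) (S j))\<^sup>2 - \<epsilon> * E j) \<le> C\<^sub>o\<^sub>r\<^sub>t\<^sub>h \<epsilon> * E n"
      using orth[unfolded quasi_orthogonality_def Let_def, rule_format, OF \<epsilon>, of n N'] N' that(2)
      unfolding D_def E_def S_def by simp
    then show ?thesis
      unfolding N'(1) C_def
      using N' that(2) \<delta> Ce \<epsilon> Corth_pos[OF \<epsilon>] contr
      by (intro sum_bound_of_perturbed_contraction[where D = "\<lambda>j. (d (S (Suc j)) (S j))\<^sup>2" and \<epsilon> = \<epsilon>])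
        (auto simp: E_def \<epsilon>_def)
  qed
  have "(\<Sum>l\<in>doerfler_steps \<theta> e T \<inter> {m..L}. (total_est e (T l))\<^sup>2) \<le> C * C\<^sub>m\<^sub>o\<^sub>n * (total_est e (T m))\<^sup>2" for m L
    unfolding D_def[symmetric]
  proof (rule sum_le_of_enumerated_sums)
    show "(total_est e (T k))\<^sup>2 \<le> C\<^sub>m\<^sub>o\<^sub>n * (total_est e (T m))\<^sup>2" if "m \<le> k" for k
      using quasi_monotone seq that by blast
  qed (use tails C Cmon in \<open>auto simp: E_def S_def\<close>)
  moreover have "0 < C * C\<^sub>m\<^sub>o\<^sub>n"
    using C Cmon by (intro mult_pos_pos) auto
  ultimately show ?thesis
    using that by blast
qed

end

section \<open>Linear convergence of the estimator product\<close>

text \<open>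
  The first term is at least the fraction \<open>1 / K\<close> of every sum that it starts, so dropping it
  shrinks the sum by the factor \<open>1 - 1 / K\<close>.
\<close>
lemma linear_decay_of_summable_tails:
  fixes p :: "nat \<Rightarrow> real"
  assumes nonneg: "\<And>l. 0 \<le> p l"
    and tails: "\<And>m L. (\<Sum>l=m..L. p l) \<le> K * p m"
    and K: "1 \<le> K"
  shows "p (m + n) \<le> K * (1 - 1 / K) ^ n * p m"
proof -
  have shrink: "(\<Sum>l=m+k..m+n. p l) \<le> (1 - 1 / K) ^ k * (\<Sum>l=m..m+n. p l)" if "k \<le> n" for k
    using that
  proof (induction k)
    case (Suc k)
    define X where "X = (\<Sum>l=m+k..m+n. p l)"
    have "X = p (m + k) + (\<Sum>l=Suc (m+k)..m+n. p l)"
      unfolding X_def using Suc.prems by (intro sum.atLeast_Suc_atMost) simp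
    moreover have "X / K \<le> p (m + k)"
      using tails[of "m + k" "m + n"] K by (simp add: X_def divide_le_eq mult.commute)
    ultimately have "(\<Sum>l=m+Suc k..m+n. p l) \<le> (1 - 1 / K) * X"
      by (simp add: left_diff_distrib)
    also have "\<dots> \<le> (1 - 1 / K) * ((1 - 1 / K) ^ k * (\<Sum>l=m..m+n. p l))"
      using Suc K unfolding X_def by (intro mult_left_mono) auto
    finally show ?case
      by (simp add: mult.assoc)
  qed simp
  have "p (m + n) \<le> (1 - 1 / K) ^ n * (\<Sum>l=m..m+n. p l)"
    using shrink[of n] by simp
  also have "\<dots> \<le> (1 - 1 / K) ^ n * (K * p m)"
    using tails K by (intro mult_left_mono zero_le_power) auto
  finally show ?thesis
    by (simp add: mult_ac)
qed

locale goal_adaptive =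
  fixes \<theta> C\<^sub>m\<^sub>a\<^sub>r\<^sub>k C\<^sub>m\<^sub>e\<^sub>s\<^sub>h C\<^sub>d\<^sub>i\<^sub>s\<^sub>t C\<^sub>s\<^sub>t\<^sub>b q\<^sub>r\<^sub>e\<^sub>d C\<^sub>r\<^sub>e\<^sub>d C\<^sub>r\<^sub>e\<^sub>l :: real
    and C\<^sub>o\<^sub>r\<^sub>t\<^sub>h :: "real \<Rightarrow> real"
    and refine :: "'e mesh \<Rightarrow> 'e mesh \<Rightarrow> 'e mesh" and T0 :: "'e mesh"
    and \<eta> :: "label \<Rightarrow> 'e estimator" and d :: "label \<Rightarrow> 'e distance"
    and T :: "nat \<Rightarrow> 'e mesh" and M :: "nat \<Rightarrow> 'e mesh"
  assumes const: "1 \<le> C\<^sub>m\<^sub>a\<^sub>r\<^sub>k" "0 < C\<^sub>m\<^sub>e\<^sub>s\<^sub>h" "0 < C\<^sub>s\<^sub>t\<^sub>b" "0 < q\<^sub>r\<^sub>e\<^sub>d" "q\<^sub>r\<^sub>e\<^sub>d < 1"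
      "0 < C\<^sub>r\<^sub>e\<^sub>d" "0 < C\<^sub>r\<^sub>e\<^sub>l"
    and Corth_pos: "\<And>\<epsilon>. \<epsilon> > 0 \<Longrightarrow> C\<^sub>o\<^sub>r\<^sub>t\<^sub>h \<epsilon> > 0"
    and theta: "0 < \<theta>" "\<theta> \<le> 1"
    and setting: "goal_adaptive_setting \<theta> C\<^sub>m\<^sub>a\<^sub>r\<^sub>k C\<^sub>m\<^sub>e\<^sub>s\<^sub>h C\<^sub>d\<^sub>i\<^sub>s\<^sub>t C\<^sub>s\<^sub>t\<^sub>b q\<^sub>r\<^sub>e\<^sub>d C\<^sub>r\<^sub>e\<^sub>d C\<^sub>o\<^sub>r\<^sub>t\<^sub>h C\<^sub>r\<^sub>e\<^sub>l
      refine T0 \<eta> d T M"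
begin

sublocale mesh_refinement refine T0
  using setting unfolding goal_adaptive_setting_def by unfold_locales auto

sublocale estimator: estimator_axioms refine T0 C\<^sub>d\<^sub>i\<^sub>s\<^sub>t C\<^sub>s\<^sub>t\<^sub>b q\<^sub>r\<^sub>e\<^sub>d C\<^sub>r\<^sub>e\<^sub>d C\<^sub>r\<^sub>e\<^sub>l "\<eta> w" "d w" for w
  using setting const unfolding goal_adaptive_setting_def by unfold_locales auto

abbreviation C\<^sub>m\<^sub>o\<^sub>n :: real where
  "C\<^sub>m\<^sub>o\<^sub>n \<equiv> monotonicity_const C\<^sub>s\<^sub>t\<^sub>b C\<^sub>r\<^sub>e\<^sub>d C\<^sub>d\<^sub>i\<^sub>s\<^sub>t C\<^sub>r\<^sub>e\<^sub>l"

abbreviation estimator_product :: "nat \<Rightarrow> real" where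
  "estimator_product l \<equiv> total_est (\<eta> Primal) (T l) * total_est (\<eta> Dual) (T l)"

lemma monotonicity_const_ge: "1 \<le> C\<^sub>m\<^sub>o\<^sub>n"
  using monotonicity_const_ge_1 const by blast

lemma algorithm: "goal_algorithm \<theta> C\<^sub>m\<^sub>a\<^sub>r\<^sub>k refine T0 (\<eta> Primal) (\<eta> Dual) T M"
  using setting unfolding goal_adaptive_setting_def by simp

lemma meshes:
  "T 0 = T0" "M l \<subseteq> T l" "T (Suc l) = refine (T l) (M l)"
  "\<theta> * rho_sq (\<eta> Primal) (\<eta> Dual) (T l) (T l) \<le> rho_sq (\<eta> Primal) (\<eta> Dual) (T l) (M l)"
  using algorithm unfolding goal_algorithm_def by simp_all

lemma marking_almost_minimal:
  assumes "R \<subseteq> T l"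
    "\<theta> * rho_sq (\<eta> Primal) (\<eta> Dual) (T l) (T l) \<le> rho_sq (\<eta> Primal) (\<eta> Dual) (T l) R"
  shows "real (card (M l)) \<le> C\<^sub>m\<^sub>a\<^sub>r\<^sub>k * real (card R)"
  using algorithm assms unfolding goal_algorithm_def by simp

lemma mesh_step: "T (Suc l) \<in> refinements refine (T l)"
  using meshes refinements.intros by metis

lemma mesh_refines:
  assumes "l \<le> k"
  shows "T k \<in> refinements refine (T l)"
  using assms
proof (induction rule: dec_induct)
  case (step n)
  then show ?case
    using mesh_step refinements_trans by blast
qed (rule refinements.refl)

lemma mesh_admissible: "T l \<in> admissible"
  using mesh_refines[of 0 l] meshes(1) by simp

lemma rho_sq_eq:
  "rho_sq e\<^sub>u e\<^sub>z X U = (est e\<^sub>u X U)\<^sup>2 * (total_est e\<^sub>z X)\<^sup>2 + (total_est e\<^sub>u X)\<^sup>2 * (est e\<^sub>z X U)\<^sup>2"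
  unfolding rho_sq_def est_sq by (simp add: sum.distrib flip: sum_distrib_left sum_distrib_right)

text \<open>
  Both estimators have equal weight in \<open>rho_sq\<close>: if the marked set carried less than the fraction \<open>\<theta>\<close>
  of each squared estimator, it would carry less than the fraction \<open>\<theta>\<close> of \<open>rho_sq\<close>.
\<close>
lemma doerfler_step_primal_or_dual:
  "l \<in> doerfler_steps \<theta> (\<eta> Primal) T \<or> l \<in> doerfler_steps \<theta> (\<eta> Dual) T"
proof (rule ccontr)
  define a where "a = (\<lambda>w. (total_est (\<eta> w) (T l))\<^sup>2)"
  define m where "m = (\<lambda>w. (est (\<eta> w) (T l) (M l))\<^sup>2)"
  assume neither: "\<not> ?thesis"
  have marked: "M l \<subseteq> T l - T (Suc l)"
    using strategy mesh_admissible meshes unfolding mesh_strategy_def by metis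
  have "m w \<le> (est (\<eta> w) (T l) (T l - T (Suc l)))\<^sup>2" for w
    unfolding m_def using finite_mesh[OF mesh_admissible] marked by (intro est_sq_mono) auto
  then have m: "m Primal < \<theta> * a Primal" "m Dual < \<theta> * a Dual"
    using neither unfolding doerfler_steps_def a_def by (auto simp: not_le intro: le_less_trans)
  have "0 \<le> m w" for w
    by (simp add: m_def)
  then have a: "0 < a Primal" "0 < a Dual"
    using m theta by (metis le_less_trans zero_less_mult_pos)+
  have "m Primal * a Dual + a Primal * m Dual < \<theta> * a Primal * a Dual + a Primal * (\<theta> * a Dual)"
    using m a by (intro add_strict_mono mult_strict_right_mono mult_strict_left_mono) auto
  moreover have "\<theta> * (a Primal * a Dual + a Primal * a Dual) \<le> m Primal * a Dual + a Primal * m Dual"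
    using meshes(4)[of l] unfolding rho_sq_eq a_def m_def .
  ultimately show False
    by (simp add: algebra_simps)
qed

lemma linear_convergence_exists:
  obtains C q where "0 < C" "0 < q" "q < 1" "linear_convergence C q T (\<eta> Primal) (\<eta> Dual)"
proof -
  define a where "a = (\<lambda>w l. (total_est (\<eta> w) (T l))\<^sup>2)"
  define D where "D = (\<lambda>w. doerfler_steps \<theta> (\<eta> w) T)"
  have a0: "0 \<le> a w l" for w l
    by (simp add: a_def)
  have orth: "quasi_orthogonality C\<^sub>o\<^sub>r\<^sub>t\<^sub>h \<theta> T (\<eta> w) (d w)" for w
    using setting unfolding goal_adaptive_setting_def by simp
  have "\<exists>C>0. \<forall>m L. (\<Sum>l\<in>D w \<inter> {m..L}. a w l) \<le> C * a w m" for w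
    using estimator.doerfler_steps_summable[OF mesh_admissible mesh_refines orth Corth_pos theta const(4)]
    unfolding D_def a_def by metis
  then obtain C where C: "\<And>w. 0 < C w" "\<And>w m L. (\<Sum>l\<in>D w \<inter> {m..L}. a w l) \<le> C w * a w m"
    by metis
  have mono: "a w l \<le> C\<^sub>m\<^sub>o\<^sub>n * a w m" if "m \<le> l" for w l m
    unfolding a_def using estimator.quasi_monotone mesh_admissible mesh_refines[OF that] by blast
  define K where "K = 2 + C\<^sub>m\<^sub>o\<^sub>n * (C Primal + C Dual)"
  have "0 \<le> C\<^sub>m\<^sub>o\<^sub>n * (C Primal + C Dual)"
    using monotonicity_const_ge C(1)[of Primal] C(1)[of Dual] by simp
  then have K: "2 \<le> K"
    by (simp add: K_def)
  have half: "(\<Sum>l\<in>D w \<inter> {m..L}. a w l * a v l) \<le> C\<^sub>m\<^sub>o\<^sub>n * C w * (a w m * a v m)" for w v m L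
  proof -
    have "(\<Sum>l\<in>D w \<inter> {m..L}. a w l * a v l) \<le> (\<Sum>l\<in>D w \<inter> {m..L}. a w l * (C\<^sub>m\<^sub>o\<^sub>n * a v m))"
      using mono a0 by (intro sum_mono mult_left_mono) auto
    also have "\<dots> = (\<Sum>l\<in>D w \<inter> {m..L}. a w l) * (C\<^sub>m\<^sub>o\<^sub>n * a v m)"
      by (simp add: sum_distrib_right)
    also have "\<dots> \<le> C w * a w m * (C\<^sub>m\<^sub>o\<^sub>n * a v m)"
      using C(2) a0 monotonicity_const_ge by (intro mult_right_mono) auto
    finally show ?thesis
      by (simp add: mult_ac)
  qed
  have tails: "(\<Sum>l=m..L. a Primal l * a Dual l) \<le> K * (a Primal m * a Dual m)" for m L
  proof -
    let ?p = "\<lambda>l. a Primal l * a Dual l"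
    have cover: "{m..L} = (D Primal \<inter> {m..L}) \<union> (D Dual \<inter> {m..L})"
      using doerfler_step_primal_or_dual unfolding D_def by blast
    have "sum ?p ((D Primal \<inter> {m..L}) \<union> (D Dual \<inter> {m..L}))
        + sum ?p ((D Primal \<inter> {m..L}) \<inter> (D Dual \<inter> {m..L}))
        = sum ?p (D Primal \<inter> {m..L}) + sum ?p (D Dual \<inter> {m..L})"
      by (intro sum.union_inter) auto
    moreover have "0 \<le> sum ?p ((D Primal \<inter> {m..L}) \<inter> (D Dual \<inter> {m..L}))"
      using a0 by (intro sum_nonneg) simp
    ultimately have "sum ?p {m..L} \<le> sum ?p (D Primal \<inter> {m..L}) + sum ?p (D Dual \<inter> {m..L})"
      unfolding cover[symmetric] by linarith
    also have "\<dots> \<le> C\<^sub>m\<^sub>o\<^sub>n * C Primal * ?p m + C\<^sub>m\<^sub>o\<^sub>n * C Dual * ?p m"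
      using half[of Primal Dual m L] half[of Dual Primal m L] by (simp add: mult_ac)
    also have "\<dots> \<le> K * ?p m"
      using a0[of Primal m] a0[of Dual m] by (simp add: K_def algebra_simps)
    finally show ?thesis .
  qed
  have decay: "a Primal (l + n) * a Dual (l + n) \<le> K * (1 - 1 / K) ^ n * (a Primal l * a Dual l)" for l n
    using K a0 tails by (intro linear_decay_of_summable_tails) auto
  have "linear_convergence (sqrt K) (sqrt (1 - 1 / K)) T (\<eta> Primal) (\<eta> Dual)"
    unfolding linear_convergence_def
  proof (intro allI)
    fix l n
    have "(estimator_product (l + n))\<^sup>2 \<le> K * (1 - 1 / K) ^ n * (estimator_product l)\<^sup>2"
      using decay[of l n] by (simp add: a_def power_mult_distrib)
    also have "\<dots> = (sqrt K * sqrt (1 - 1 / K) ^ n * estimator_product l)\<^sup>2"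
      using K by (simp add: power_mult_distrib real_sqrt_power[symmetric])
    finally show "estimator_product (l + n) \<le> sqrt K * sqrt (1 - 1 / K) ^ n * estimator_product l"
      by (rule power2_le_imp_le) (use K in \<open>auto intro!: mult_nonneg_nonneg est_nonneg\<close>)
  qed
  then show ?thesis
    using K by (intro that[of "sqrt K" "sqrt (1 - 1 / K)"]) auto
qed

section \<open>Optimal rates\<close>

text \<open>
  The set \<open>R\<close> of Doerfler optimality, for the estimator that drops on the overlay, competes with
  the marked set, which is almost minimal.
\<close>
lemma marked_card_le:
  assumes \<delta>\<kappa>: "0 < \<delta>" "0 < \<kappa>"
    and param: "2 * \<theta> * (1 + (1 + \<delta>) * (C\<^sub>s\<^sub>t\<^sub>b\<^sup>2 * C\<^sub>r\<^sub>e\<^sub>l\<^sup>2)) \<le> 1 - (1 + 1 / \<delta>) * \<kappa>"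
    and pos: "0 < estimator_product l" "0 < s" "0 < t" "0 \<le> A" "0 \<le> B"
    and A: "\<And>N. best_est refine T0 (\<eta> Primal) N \<le> A * (real N + 1) powr - s"
    and B: "\<And>N. best_est refine T0 (\<eta> Dual) N \<le> B * (real N + 1) powr - t"
  shows "real (card (M l)) \<le>
    2 * C\<^sub>m\<^sub>a\<^sub>r\<^sub>k * C\<^sub>r\<^sub>e\<^sub>l * (A * B * C\<^sub>m\<^sub>o\<^sub>n / (\<kappa> * estimator_product l)) powr (1 / (s + t))"
proof -
  define p where "p = estimator_product l"
  define Y where "Y = A * B * C\<^sub>m\<^sub>o\<^sub>n / (\<kappa> * p)"
  define X where "X = Y powr (1 / (s + t))"
  \<comment> \<open>Up to the constants, \<open>X\<close> is where the best possible product falls below \<open>\<kappa> * p\<close>. The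
    truncated subtraction yields \<open>N = 0\<close> if \<open>X = 0\<close>, so that \<open>N \<le> X \<le> N + 1\<close> in all cases.\<close>
  define N where "N = nat \<lceil>X\<rceil> - 1"
  note Cmon = monotonicity_const_ge
  have p: "0 < p"
    using pos by (simp add: p_def)
  have Y0: "0 \<le> Y"
    using pos p \<delta>\<kappa> Cmon by (simp add: Y_def)
  have X0: "0 \<le> X"
    by (simp add: X_def)
  have N: "real N \<le> X" "X \<le> real N + 1"
    using X0 unfolding N_def by linarith+
  have "Y = X powr (s + t)"
    unfolding X_def using pos Y0 by (simp add: powr_powr)
  also have "\<dots> \<le> (real N + 1) powr (s + t)"
    using N X0 pos by (intro powr_mono2) auto
  finally have N_large: "A * B * C\<^sub>m\<^sub>o\<^sub>n \<le> \<kappa> * p * (real N + 1) powr (s + t)"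
    using p \<delta>\<kappa> by (simp add: Y_def pos_divide_le_eq mult.commute)
  obtain T1 where T1: "T1 \<in> mesh_class refine T0 N"
      "total_est (\<eta> Primal) T1 = best_est refine T0 (\<eta> Primal) N"
    by (rule best_est_attained)
  obtain T2 where T2: "T2 \<in> mesh_class refine T0 N"
      "total_est (\<eta> Dual) T2 = best_est refine T0 (\<eta> Dual) N"
    by (rule best_est_attained)
  obtain T' where T': "T' \<in> refinements refine (T l)" "T' \<in> refinements refine T1"
      "T' \<in> refinements refine T2" "real (card T') \<le> real (card (T l)) + 2 * real N"
    using overlay_three[OF mesh_admissible T1(1) T2(1)] .
  define x where "x = (\<lambda>w. total_est (\<eta> w) T')"
  define y where "y = (\<lambda>w. total_est (\<eta> w) (T l))"
  have p_eq: "p = y Primal * y Dual"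
    by (simp add: p_def y_def)
  have "total_est (\<eta> Primal) T1 * total_est (\<eta> Dual) T2
      \<le> (A * (real N + 1) powr - s) * (B * (real N + 1) powr - t)"
    unfolding T1 T2 using A B pos best_est_nonneg by (intro mult_mono) auto
  also have "\<dots> = A * B / (real N + 1) powr (s + t)"
    by (simp add: powr_minus powr_add divide_simps)
  finally have best: "C\<^sub>m\<^sub>o\<^sub>n * (total_est (\<eta> Primal) T1 * total_est (\<eta> Dual) T2) \<le> \<kappa> * p"
  proof -
    assume "total_est (\<eta> Primal) T1 * total_est (\<eta> Dual) T2 \<le> A * B / (real N + 1) powr (s + t)"
    then have "C\<^sub>m\<^sub>o\<^sub>n * (total_est (\<eta> Primal) T1 * total_est (\<eta> Dual) T2)
        \<le> C\<^sub>m\<^sub>o\<^sub>n * (A * B / (real N + 1) powr (s + t))"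
      using Cmon by (intro mult_left_mono) auto
    also have "\<dots> \<le> \<kappa> * p"
      using N_large by (simp add: pos_divide_le_eq mult_ac)
    finally show ?thesis .
  qed
  have "T1 \<in> admissible" "T2 \<in> admissible"
    using T1 T2 by (simp_all add: mesh_class_def)
  then have "(x Primal)\<^sup>2 * (x Dual)\<^sup>2 \<le>
      (C\<^sub>m\<^sub>o\<^sub>n * (total_est (\<eta> Primal) T1)\<^sup>2) * (C\<^sub>m\<^sub>o\<^sub>n * (total_est (\<eta> Dual) T2)\<^sup>2)"
    unfolding x_def using T' estimator.quasi_monotone Cmon by (intro mult_mono) auto
  also have "\<dots> = (C\<^sub>m\<^sub>o\<^sub>n * (total_est (\<eta> Primal) T1 * total_est (\<eta> Dual) T2))\<^sup>2"
    by (simp add: power_mult_distrib power2_eq_square)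
  also have "\<dots> \<le> (\<kappa> * p)\<^sup>2"
    using best Cmon by (intro power_mono) (auto intro!: mult_nonneg_nonneg est_nonneg)
  finally have product_small: "(x Primal)\<^sup>2 * (x Dual)\<^sup>2 \<le> (\<kappa> * p)\<^sup>2" .
  have "\<exists>w. (x w)\<^sup>2 \<le> \<kappa> * (y w)\<^sup>2"
  proof (rule ccontr)
    assume "\<not> ?thesis"
    then have "(\<kappa> * (y Primal)\<^sup>2) * (\<kappa> * (y Dual)\<^sup>2) < (x Primal)\<^sup>2 * (x Dual)\<^sup>2"
      using \<delta>\<kappa> by (intro mult_strict_mono') (auto simp: not_le)
    then show False
      using product_small unfolding p_eq by (simp add: power_mult_distrib power2_eq_square mult_ac)
  qed
  then obtain w where w: "(total_est (\<eta> w) T')\<^sup>2 \<le> \<kappa> * (total_est (\<eta> w) (T l))\<^sup>2"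
    by (auto simp: x_def y_def)
  obtain R where R: "R \<subseteq> T l" "real (card R) \<le> C\<^sub>r\<^sub>e\<^sub>l * real (card (T l - T'))"
      "2 * \<theta> * (total_est (\<eta> w) (T l))\<^sup>2 \<le> (est (\<eta> w) (T l) R)\<^sup>2"
    using estimator.doerfler_optimality[OF mesh_admissible T'(1) \<delta>\<kappa> param w] .
  have "\<theta> * rho_sq (\<eta> Primal) (\<eta> Dual) (T l) (T l) \<le> rho_sq (\<eta> Primal) (\<eta> Dual) (T l) R"
  proof (cases w)
    case Primal
    then show ?thesis
      using mult_right_mono[OF R(3), of "(y Dual)\<^sup>2"]
      by (auto simp: rho_sq_eq y_def algebra_simps intro: add_increasing add_increasing2)
  next
    case Dual
    then show ?thesis
      using mult_left_mono[OF R(3), of "(y Primal)\<^sup>2"]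
      by (auto simp: rho_sq_eq y_def algebra_simps intro: add_increasing add_increasing2)
  qed
  then have "real (card (M l)) \<le> C\<^sub>m\<^sub>a\<^sub>r\<^sub>k * real (card R)"
    by (rule marking_almost_minimal[OF R(1)])
  also have "\<dots> \<le> C\<^sub>m\<^sub>a\<^sub>r\<^sub>k * (C\<^sub>r\<^sub>e\<^sub>l * (2 * X))"
  proof (intro mult_left_mono)
    have "real (card (T l - T')) \<le> 2 * X"
      using refined_elements_card[OF mesh_admissible T'(1)] T'(4) N(1) by linarith
    then show "real (card R) \<le> C\<^sub>r\<^sub>e\<^sub>l * (2 * X)"
      using R(2) const by (meson less_imp_le mult_left_mono order_trans)
  qed (use const in auto)
  finally show ?thesis
    by (simp add: X_def Y_def p_def mult_ac)
qed

text \<open>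
  By linear convergence the bounds on the marked sets grow geometrically in \<open>j\<close>, with ratio
  \<open>q powr (1 / (s + t))\<close>, so that their sum is comparable with the last one. Solving the resulting
  bound on the number of new elements for the estimator product gives the rate.
\<close>
lemma product_rate:
  assumes \<delta>\<kappa>: "0 < \<delta>" "0 < \<kappa>"
    and param: "2 * \<theta> * (1 + (1 + \<delta>) * (C\<^sub>s\<^sub>t\<^sub>b\<^sup>2 * C\<^sub>r\<^sub>e\<^sub>l\<^sup>2)) \<le> 1 - (1 + 1 / \<delta>) * \<kappa>"
    and lin: "0 < C\<^sub>l\<^sub>i\<^sub>n" "0 < q" "q < 1" "linear_convergence C\<^sub>l\<^sub>i\<^sub>n q T (\<eta> Primal) (\<eta> Dual)"
    and Copt: "2 * C\<^sub>m\<^sub>e\<^sub>s\<^sub>h * C\<^sub>m\<^sub>a\<^sub>r\<^sub>k * C\<^sub>r\<^sub>e\<^sub>l \<le> C\<^sub>o\<^sub>p\<^sub>t" "C\<^sub>m\<^sub>o\<^sub>n * C\<^sub>l\<^sub>i\<^sub>n / \<kappa> \<le> C\<^sub>o\<^sub>p\<^sub>t"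
    and pos: "0 < s" "0 < t" "0 \<le> A" "0 \<le> B"
    and A: "\<And>N. best_est refine T0 (\<eta> Primal) N \<le> A * (real N + 1) powr - s"
    and B: "\<And>N. best_est refine T0 (\<eta> Dual) N \<le> B * (real N + 1) powr - t"
    and refined: "card (T l) \<noteq> card T0"
  shows "estimator_product l \<le> C\<^sub>o\<^sub>p\<^sub>t powr (1 + s + t) / (1 - q powr (1 / (s + t))) powr (s + t)
    * A * B * (real (card (T l)) - real (card T0)) powr - (s + t)"
proof (cases "estimator_product l = 0")
  case True
  show ?thesis
    unfolding True using pos by (intro mult_nonneg_nonneg divide_nonneg_nonneg) auto
next
  case False
  define \<sigma> where "\<sigma> = s + t"
  define r where "r = q powr (1 / \<sigma>)"
  define p where "p = estimator_product l"
  define H where "H = C\<^sub>m\<^sub>o\<^sub>n * C\<^sub>l\<^sub>i\<^sub>n / \<kappa>"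
  define G where "G = 2 * C\<^sub>m\<^sub>e\<^sub>s\<^sub>h * C\<^sub>m\<^sub>a\<^sub>r\<^sub>k * C\<^sub>r\<^sub>e\<^sub>l"
  define Z where "Z = A * B * H / p"
  define n where "n = real (card (T l)) - real (card T0)"
  note Cmon = monotonicity_const_ge
  have \<sigma>: "0 < \<sigma>"
    using pos by (simp add: \<sigma>_def)
  have p: "0 < p"
    using False by (simp add: p_def est_nonneg less_le)
  have n: "0 < n"
    using card_initial_le[OF mesh_admissible, of l] refined by (simp add: n_def)
  have r: "0 < r" "r < 1"
    using lin \<sigma> powr_less_mono2[of "1 / \<sigma>" q 1] by (auto simp: r_def)
  have H: "0 < H"
    using Cmon lin \<delta>\<kappa> by (simp add: H_def)
  have G: "0 < G"
    using const by (simp add: G_def)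
  have Z: "0 \<le> Z"
    using pos H p by (simp add: Z_def)
  have marked: "real (card (M j)) \<le> 2 * C\<^sub>m\<^sub>a\<^sub>r\<^sub>k * C\<^sub>r\<^sub>e\<^sub>l * (Z powr (1 / \<sigma>) * r ^ (l - Suc j))" if "j < l" for j
  proof -
    define pj where "pj = estimator_product j"
    have decay: "p \<le> C\<^sub>l\<^sub>i\<^sub>n * q ^ (l - j) * pj"
      using lin(4)[unfolded linear_convergence_def, rule_format, of j "l - j"] that
      by (simp add: p_def pj_def)
    then have "0 < C\<^sub>l\<^sub>i\<^sub>n * q ^ (l - j) * pj"
      using p by linarith
    then have pj: "0 < pj"
      by (rule zero_less_mult_pos) (use lin in simp)
    have "A * B * C\<^sub>m\<^sub>o\<^sub>n / (\<kappa> * pj) \<le> Z * q ^ (l - j)"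
    proof -
      have "A * B * C\<^sub>m\<^sub>o\<^sub>n / \<kappa> * p \<le> A * B * C\<^sub>m\<^sub>o\<^sub>n / \<kappa> * (C\<^sub>l\<^sub>i\<^sub>n * q ^ (l - j) * pj)"
        using decay pos Cmon \<delta>\<kappa> by (intro mult_left_mono) auto
      then show ?thesis
        using p pj \<delta>\<kappa> by (simp add: Z_def H_def field_simps)
    qed
    then have "(A * B * C\<^sub>m\<^sub>o\<^sub>n / (\<kappa> * pj)) powr (1 / \<sigma>) \<le> (Z * q ^ (l - j)) powr (1 / \<sigma>)"
      using pos Cmon \<delta>\<kappa> pj \<sigma> by (intro powr_mono2) auto
    also have "\<dots> = Z powr (1 / \<sigma>) * r ^ (l - j)"
      using Z lin by (simp add: powr_mult r_def powr_realpow[symmetric] powr_powr mult.commute)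
    also have "\<dots> \<le> Z powr (1 / \<sigma>) * r ^ (l - Suc j)"
      using r that by (intro mult_left_mono power_decreasing) auto
    finally have "2 * C\<^sub>m\<^sub>a\<^sub>r\<^sub>k * C\<^sub>r\<^sub>e\<^sub>l * (A * B * C\<^sub>m\<^sub>o\<^sub>n / (\<kappa> * pj)) powr (1 / \<sigma>)
        \<le> 2 * C\<^sub>m\<^sub>a\<^sub>r\<^sub>k * C\<^sub>r\<^sub>e\<^sub>l * (Z powr (1 / \<sigma>) * r ^ (l - Suc j))"
      using const by (intro mult_left_mono) auto
    then show ?thesis
      using marked_card_le[OF \<delta>\<kappa> param pj[unfolded pj_def] pos A B]
      unfolding pj_def \<sigma>_def by linarith
  qed
  have geometric: "(\<Sum>j<l. r ^ (l - Suc j)) \<le> 1 / (1 - r)"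
  proof -
    have "(\<Sum>j<l. r ^ (l - Suc j)) = (1 - r ^ l) / (1 - r)"
      using r by (simp add: sum.nat_diff_reindex sum_gp_strict)
    also have "\<dots> \<le> 1 / (1 - r)"
      using r by (intro divide_right_mono) auto
    finally show ?thesis .
  qed
  have "closure_estimate C\<^sub>m\<^sub>e\<^sub>s\<^sub>h refine T0"
    using setting unfolding goal_adaptive_setting_def by simp
  then have "n \<le> C\<^sub>m\<^sub>e\<^sub>s\<^sub>h * (\<Sum>j<l. real (card (M j)))"
    unfolding closure_estimate_def n_def using meshes by blast
  also have "\<dots> \<le> C\<^sub>m\<^sub>e\<^sub>s\<^sub>h * (\<Sum>j<l. 2 * C\<^sub>m\<^sub>a\<^sub>r\<^sub>k * C\<^sub>r\<^sub>e\<^sub>l * (Z powr (1 / \<sigma>) * r ^ (l - Suc j)))"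
    using marked const by (intro mult_left_mono sum_mono) auto
  also have "\<dots> = G * Z powr (1 / \<sigma>) * (\<Sum>j<l. r ^ (l - Suc j))"
    by (simp add: G_def sum_distrib_left mult_ac)
  also have "\<dots> \<le> G * Z powr (1 / \<sigma>) * (1 / (1 - r))"
    using geometric G by (intro mult_left_mono) auto
  finally have "n \<le> G * Z powr (1 / \<sigma>) / (1 - r)"
    by simp
  then have "n powr \<sigma> \<le> (G * Z powr (1 / \<sigma>) / (1 - r)) powr \<sigma>"
    using n \<sigma> by (intro powr_mono2) auto
  also have "\<dots> = G powr \<sigma> * Z / (1 - r) powr \<sigma>"
    using G Z r \<sigma> by (simp add: powr_mult powr_divide powr_powr)
  finally have "n powr \<sigma> \<le> G powr \<sigma> * Z / (1 - r) powr \<sigma>" .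
  then have "p * n powr \<sigma> \<le> p * (G powr \<sigma> * Z / (1 - r) powr \<sigma>)"
    using p by (intro mult_left_mono) auto
  also have "\<dots> = (G powr \<sigma> * H) * (A * B / (1 - r) powr \<sigma>)"
    using p by (simp add: Z_def)
  also have "\<dots> \<le> C\<^sub>o\<^sub>p\<^sub>t powr (1 + \<sigma>) * (A * B / (1 - r) powr \<sigma>)"
  proof (intro mult_right_mono)
    have "G powr \<sigma> * H \<le> C\<^sub>o\<^sub>p\<^sub>t powr \<sigma> * C\<^sub>o\<^sub>p\<^sub>t"
      using Copt G H \<sigma> unfolding G_def[symmetric] H_def[symmetric]
      by (intro mult_mono powr_mono2) auto
    then show "G powr \<sigma> * H \<le> C\<^sub>o\<^sub>p\<^sub>t powr (1 + \<sigma>)"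
      using Copt(1) G unfolding G_def[symmetric] by (simp add: powr_add mult.commute)
  qed (use pos in auto)
  finally have "p \<le> C\<^sub>o\<^sub>p\<^sub>t powr (1 + \<sigma>) * (A * B / (1 - r) powr \<sigma>) / n powr \<sigma>"
    using n by (subst pos_le_divide_eq) auto
  then show ?thesis
    unfolding p_def[symmetric] n_def[symmetric] r_def \<sigma>_def powr_minus_divide
    by (simp add: add.assoc)
qed

end

section \<open>Rates of the individual estimators\<close>

lemma factor_rate_of_product_rate:
  fixes a b :: real
  assumes prod: "a * b \<le> K * n powr - \<sigma>" and lower: "c \<le> (n + 1) powr r * b"
    and "0 < c" "0 \<le> a" "0 \<le> K" "1 \<le> n" "0 \<le> r" "s \<le> \<sigma> - r"
  shows "a \<le> K * 2 powr r / c * n powr - s"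
proof -
  have "a * c \<le> a * ((n + 1) powr r * b)"
    using lower assms by (intro mult_left_mono) auto
  also have "\<dots> = (n + 1) powr r * (a * b)"
    by simp
  also have "\<dots> \<le> (2 * n) powr r * (K * n powr - \<sigma>)"
  proof -
    have "(n + 1) powr r * (a * b) \<le> (n + 1) powr r * (K * n powr - \<sigma>)"
      using prod by (intro mult_left_mono) auto
    also have "\<dots> \<le> (2 * n) powr r * (K * n powr - \<sigma>)"
      using assms by (intro mult_right_mono powr_mono2) auto
    finally show ?thesis .
  qed
  also have "\<dots> = K * 2 powr r * n powr (r - \<sigma>)"
    using assms by (simp add: powr_mult powr_diff powr_minus divide_inverse)
  also have "\<dots> \<le> K * 2 powr r * n powr - s"
    using assms by (intro mult_left_mono powr_mono) auto
  finally show ?thesis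
    using assms by (simp add: field_simps)
qed

lemma attained_rate_near_max_rate:
  assumes "max_rate refine T0 e = ereal m" "r < m"
  obtains s where "r < s" "0 < s" "approx_norm refine T0 e s < \<infinity>"
proof -
  let ?S = "{s. 0 < s \<and> approx_norm refine T0 e s < \<infinity>}"
  have "ereal r < (SUP s\<in>?S. ereal s)"
    using assms unfolding max_rate_def by simp
  then obtain s where s: "s \<in> ?S" "ereal r < ereal s"
    unfolding less_SUP_iff by blast
  then show ?thesis
    using that[of s] by simp
qed

context mesh_refinement
begin

text \<open>
  A mesh is one of the competitors for the number of its additional elements, so sharpness bounds
  every mesh from below.
\<close>
lemma sharp_max_rate_lower_bound:
  assumes "sharp_max_rate refine T0 e" "max_rate refine T0 e < ereal r"
  obtains c where "0 < c" "\<And>T. T \<in> admissible \<Longrightarrow>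
    c \<le> (real (card T) - real (card T0) + 1) powr r * total_est e T"
proof -
  obtain c where c: "0 < c" "\<And>N. c \<le> (real N + 1) powr r * best_est refine T0 e N"
    using assms unfolding sharp_max_rate_def by blast
  have "c \<le> (real (card T) - real (card T0) + 1) powr r * total_est e T" if T: "T \<in> admissible" for T
  proof -
    define N where "N = card T - card T0"
    have N: "real N = real (card T) - real (card T0)"
      using card_initial_le[OF T] by (simp add: N_def)
    then have "T \<in> mesh_class refine T0 N"
      using T by (simp add: mesh_class_def)
    then have "(real N + 1) powr r * best_est refine T0 e N \<le> (real N + 1) powr r * total_est e T"
      by (intro mult_left_mono best_est_le) auto
    then show ?thesis
      using c(2)[of N] unfolding N by linarith
  qed
  then show ?thesis
    using that c(1) by blast
qed

end

text \<open>
  The product decays with a rate \<open>s' + t'\<close> close to the sum of the maximal rates, and by sharpness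
  the dual estimator decays at most with a rate slightly above its own maximum. The difference,
  which is left for the primal estimator, exceeds \<open>s\<close>; likewise with exchanged roles.
\<close>
lemma (in goal_adaptive) individual_rates:
  assumes \<delta>\<kappa>: "0 < \<delta>" "0 < \<kappa>"
    and param: "2 * \<theta> * (1 + (1 + \<delta>) * (C\<^sub>s\<^sub>t\<^sub>b\<^sup>2 * C\<^sub>r\<^sub>e\<^sub>l\<^sup>2)) \<le> 1 - (1 + 1 / \<delta>) * \<kappa>"
    and finite: "max_rate refine T0 (\<eta> Primal) < \<infinity>" "max_rate refine T0 (\<eta> Dual) < \<infinity>"
    and sharp: "sharp_max_rate refine T0 (\<eta> Primal)" "sharp_max_rate refine T0 (\<eta> Dual)"
    and s: "0 < s" "ereal s < max_rate refine T0 (\<eta> Primal)"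
    and t: "0 < t" "ereal t < max_rate refine T0 (\<eta> Dual)"
  shows "\<exists>C>0. \<forall>l. card (T l) \<noteq> card T0 \<longrightarrow>
    total_est (\<eta> Primal) (T l) \<le> C * (real (card (T l)) - real (card T0)) powr - s \<and>
    total_est (\<eta> Dual) (T l) \<le> C * (real (card (T l)) - real (card T0)) powr - t"
proof -
  obtain m where m: "max_rate refine T0 (\<eta> Primal) = ereal m"
    using finite(1) s by (cases "max_rate refine T0 (\<eta> Primal)") auto
  obtain m' where m': "max_rate refine T0 (\<eta> Dual) = ereal m'"
    using finite(2) t by (cases "max_rate refine T0 (\<eta> Dual)") auto
  have sm: "s < m" and tm: "t < m'"
    using s t m m' by auto
  \<comment> \<open>The distance to the maximal rates is lost three times: in each of \<open>s'\<close> and \<open>t'\<close>, and in the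
    lower bound of the other factor.\<close>
  define h where "h = min (m - s) (m' - t) / 3"
  have h: "0 < h" "3 * h \<le> m - s" "3 * h \<le> m' - t"
    using sm tm by (auto simp: h_def)
  obtain s' where s': "m - h < s'" "0 < s'" "approx_norm refine T0 (\<eta> Primal) s' < \<infinity>"
    using attained_rate_near_max_rate[OF m, of "m - h"] h by auto
  obtain t' where t': "m' - h < t'" "0 < t'" "approx_norm refine T0 (\<eta> Dual) t' < \<infinity>"
    using attained_rate_near_max_rate[OF m', of "m' - h"] h by auto
  obtain A where A: "0 \<le> A" "\<And>N. best_est refine T0 (\<eta> Primal) N \<le> A * (real N + 1) powr - s'"
    using approx_norm_finite[OF s'(3)] by metis
  obtain B where B: "0 \<le> B" "\<And>N. best_est refine T0 (\<eta> Dual) N \<le> B * (real N + 1) powr - t'"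
    using approx_norm_finite[OF t'(3)] by metis
  obtain cu where cu: "0 < cu" "\<And>X. X \<in> admissible \<Longrightarrow>
      cu \<le> (real (card X) - real (card T0) + 1) powr (m + h) * total_est (\<eta> Primal) X"
    using sharp_max_rate_lower_bound[OF sharp(1), of "m + h"] m h by auto
  obtain cz where cz: "0 < cz" "\<And>X. X \<in> admissible \<Longrightarrow>
      cz \<le> (real (card X) - real (card T0) + 1) powr (m' + h) * total_est (\<eta> Dual) X"
    using sharp_max_rate_lower_bound[OF sharp(2), of "m' + h"] m' h by auto
  obtain Cl q where lin: "0 < Cl" "0 < q" "q < 1" "linear_convergence Cl q T (\<eta> Primal) (\<eta> Dual)"
    using linear_convergence_exists .
  define Copt where "Copt = max (2 * C\<^sub>m\<^sub>e\<^sub>s\<^sub>h * C\<^sub>m\<^sub>a\<^sub>r\<^sub>k * C\<^sub>r\<^sub>e\<^sub>l) (C\<^sub>m\<^sub>o\<^sub>n * Cl / \<kappa>)"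
  define K where "K = Copt powr (1 + s' + t') / (1 - q powr (1 / (s' + t'))) powr (s' + t') * A * B"
  have K: "0 \<le> K"
    using A B by (simp add: K_def)
  define C where "C = 1 + K * 2 powr (m' + h) / cz + K * 2 powr (m + h) / cu"
  have parts: "0 \<le> K * 2 powr (m' + h) / cz" "0 \<le> K * 2 powr (m + h) / cu"
    using K cu cz by auto
  have "total_est (\<eta> Primal) (T l) \<le> C * (real (card (T l)) - real (card T0)) powr - s \<and>
    total_est (\<eta> Dual) (T l) \<le> C * (real (card (T l)) - real (card T0)) powr - t"
    if refined: "card (T l) \<noteq> card T0" for l
  proof -
    define n where "n = real (card (T l)) - real (card T0)"
    have n: "1 \<le> n"
      using card_initial_le[OF mesh_admissible, of l] refined by (simp add: n_def)
    have prod: "estimator_product l \<le> K * n powr - (s' + t')"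
      unfolding K_def n_def
      using product_rate[OF \<delta>\<kappa> param lin _ _ s'(2) t'(2) A(1) B(1) A(2) B(2) refined]
      by (simp add: Copt_def)
    have "total_est (\<eta> Primal) (T l) \<le> K * 2 powr (m' + h) / cz * n powr - s"
      by (rule factor_rate_of_product_rate[OF prod cz(2)[OF mesh_admissible[of l], folded n_def]])
        (use cz(1) K n h s(1) t(1) s'(1) t'(1) sm tm in \<open>auto intro: est_nonneg\<close>)
    also have "\<dots> \<le> C * n powr - s"
      using parts by (intro mult_right_mono) (auto simp: C_def)
    finally have u: "total_est (\<eta> Primal) (T l) \<le> C * n powr - s" .
    have "total_est (\<eta> Dual) (T l) * total_est (\<eta> Primal) (T l) \<le> K * n powr - (s' + t')"
      using prod by (simp add: mult.commute)
    then have "total_est (\<eta> Dual) (T l) \<le> K * 2 powr (m + h) / cu * n powr - t"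
      by (rule factor_rate_of_product_rate[OF _ cu(2)[OF mesh_admissible[of l], folded n_def]])
        (use cu(1) K n h s(1) t(1) s'(1) t'(1) sm tm in \<open>auto intro: est_nonneg\<close>)
    also have "\<dots> \<le> C * n powr - t"
      using parts by (intro mult_right_mono) (auto simp: C_def)
    finally show ?thesis
      using u by (simp add: n_def)
  qed
  moreover have "0 < C"
    using parts by (simp add: C_def)
  ultimately show ?thesis
    by blast
qed

theorem theorem21:
  fixes \<theta> C\<^sub>m\<^sub>a\<^sub>r\<^sub>k C\<^sub>m\<^sub>e\<^sub>s\<^sub>h C\<^sub>d\<^sub>i\<^sub>s\<^sub>t C\<^sub>s\<^sub>t\<^sub>b q\<^sub>r\<^sub>e\<^sub>d C\<^sub>r\<^sub>e\<^sub>d C\<^sub>r\<^sub>e\<^sub>l :: real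
    and C\<^sub>o\<^sub>r\<^sub>t\<^sub>h :: "real \<Rightarrow> real"
  assumes "C\<^sub>m\<^sub>a\<^sub>r\<^sub>k \<ge> 1" "C\<^sub>m\<^sub>e\<^sub>s\<^sub>h > 0" "C\<^sub>d\<^sub>i\<^sub>s\<^sub>t > 0" "C\<^sub>s\<^sub>t\<^sub>b > 0"
    and "0 < q\<^sub>r\<^sub>e\<^sub>d" "q\<^sub>r\<^sub>e\<^sub>d < 1" "C\<^sub>r\<^sub>e\<^sub>d > 0" "C\<^sub>r\<^sub>e\<^sub>l > 0"
    and "\<And>\<epsilon>. \<epsilon> > 0 \<Longrightarrow> C\<^sub>o\<^sub>r\<^sub>t\<^sub>h \<epsilon> > 0"
    and "0 < \<theta>" "\<theta> < theta_star C\<^sub>s\<^sub>t\<^sub>b C\<^sub>r\<^sub>e\<^sub>l / 2"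
  shows
    "(\<forall>C\<^sub>l\<^sub>i\<^sub>n q\<^sub>l\<^sub>i\<^sub>n. 0 < C\<^sub>l\<^sub>i\<^sub>n \<and> 0 < q\<^sub>l\<^sub>i\<^sub>n \<and> q\<^sub>l\<^sub>i\<^sub>n < 1 \<longrightarrow>
       (\<exists>C\<^sub>o\<^sub>p\<^sub>t>0.
          \<forall>(refine :: 'e mesh \<Rightarrow> 'e mesh \<Rightarrow> 'e mesh) T0 \<eta> d T M.
            goal_adaptive_setting \<theta> C\<^sub>m\<^sub>a\<^sub>r\<^sub>k C\<^sub>m\<^sub>e\<^sub>s\<^sub>h C\<^sub>d\<^sub>i\<^sub>s\<^sub>t C\<^sub>s\<^sub>t\<^sub>b q\<^sub>r\<^sub>e\<^sub>d C\<^sub>r\<^sub>e\<^sub>d C\<^sub>o\<^sub>r\<^sub>t\<^sub>h C\<^sub>r\<^sub>e\<^sub>l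
              refine T0 \<eta> d T M \<and>
            linear_convergence C\<^sub>l\<^sub>i\<^sub>n q\<^sub>l\<^sub>i\<^sub>n T (\<eta> Primal) (\<eta> Dual) \<longrightarrow>
            (\<forall>s>0. \<forall>t>0.
               approx_norm refine T0 (\<eta> Primal) s < \<infinity> \<and> approx_norm refine T0 (\<eta> Dual) t < \<infinity> \<longrightarrow>
               (\<forall>l. card (T l) \<noteq> card T0 \<longrightarrow>
                  ereal (total_est (\<eta> Primal) (T l) * total_est (\<eta> Dual) (T l))
                    \<le> ereal (C\<^sub>o\<^sub>p\<^sub>t powr (1 + s + t) / (1 - q\<^sub>l\<^sub>i\<^sub>n powr (1 / (s + t))) powr (s + t))
                       * approx_norm refine T0 (\<eta> Primal) s * approx_norm refine T0 (\<eta> Dual) t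
                       * ereal ((real (card (T l)) - real (card T0)) powr - (s + t))))))
     \<and>
     (\<forall>(refine :: 'e mesh \<Rightarrow> 'e mesh \<Rightarrow> 'e mesh) T0 \<eta> d T M.
        goal_adaptive_setting \<theta> C\<^sub>m\<^sub>a\<^sub>r\<^sub>k C\<^sub>m\<^sub>e\<^sub>s\<^sub>h C\<^sub>d\<^sub>i\<^sub>s\<^sub>t C\<^sub>s\<^sub>t\<^sub>b q\<^sub>r\<^sub>e\<^sub>d C\<^sub>r\<^sub>e\<^sub>d C\<^sub>o\<^sub>r\<^sub>t\<^sub>h C\<^sub>r\<^sub>e\<^sub>l
          refine T0 \<eta> d T M \<and>
        max_rate refine T0 (\<eta> Primal) < \<infinity> \<and> max_rate refine T0 (\<eta> Dual) < \<infinity> \<and>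
        sharp_max_rate refine T0 (\<eta> Primal) \<and> sharp_max_rate refine T0 (\<eta> Dual) \<longrightarrow>
        (\<forall>s t. 0 < s \<and> ereal s < max_rate refine T0 (\<eta> Primal) \<and>
               0 < t \<and> ereal t < max_rate refine T0 (\<eta> Dual) \<longrightarrow>
           (\<exists>C>0. \<forall>l. card (T l) \<noteq> card T0 \<longrightarrow>
              total_est (\<eta> Primal) (T l) \<le> C * (real (card (T l)) - real (card T0)) powr - s \<and>
              total_est (\<eta> Dual) (T l) \<le> C * (real (card (T l)) - real (card T0)) powr - t)))"
proof -
  define G where "G = C\<^sub>s\<^sub>t\<^sub>b\<^sup>2 * C\<^sub>r\<^sub>e\<^sub>l\<^sup>2"
  have G: "0 \<le> G"
    by (simp add: G_def)
  have theta2: "2 * \<theta> < inverse (1 + G)"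
    using assms unfolding theta_star_def G_def by simp
  then obtain \<delta> \<kappa> where \<delta>\<kappa>: "0 < \<delta>" "0 < \<kappa>"
      and param: "2 * \<theta> * (1 + (1 + \<delta>) * G) \<le> 1 - (1 + 1 / \<delta>) * \<kappa>"
    using doerfler_parameters_exist[of "2 * \<theta>" G] G assms by auto
  note param = param[unfolded G_def]
  have "inverse (1 + G) \<le> 1"
    using G by (simp add: inverse_le_1_iff)
  then have theta: "0 < \<theta>" "\<theta> \<le> 1"
    using theta2 assms by auto
  have run: "goal_adaptive \<theta> C\<^sub>m\<^sub>a\<^sub>r\<^sub>k C\<^sub>m\<^sub>e\<^sub>s\<^sub>h C\<^sub>d\<^sub>i\<^sub>s\<^sub>t C\<^sub>s\<^sub>t\<^sub>b q\<^sub>r\<^sub>e\<^sub>d C\<^sub>r\<^sub>e\<^sub>d C\<^sub>r\<^sub>e\<^sub>l C\<^sub>o\<^sub>r\<^sub>t\<^sub>h refine T0 \<eta> d T M"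
    if "goal_adaptive_setting \<theta> C\<^sub>m\<^sub>a\<^sub>r\<^sub>k C\<^sub>m\<^sub>e\<^sub>s\<^sub>h C\<^sub>d\<^sub>i\<^sub>s\<^sub>t C\<^sub>s\<^sub>t\<^sub>b q\<^sub>r\<^sub>e\<^sub>d C\<^sub>r\<^sub>e\<^sub>d C\<^sub>o\<^sub>r\<^sub>t\<^sub>h C\<^sub>r\<^sub>e\<^sub>l refine T0 \<eta> d T M"
    for refine :: "'e mesh \<Rightarrow> 'e mesh \<Rightarrow> 'e mesh" and T0 \<eta> d T M
    using assms theta that by unfold_locales auto
  show ?thesis
  proof (rule conjI, goal_cases)
    case 1
    show ?case
    proof (intro allI impI, elim conjE)
      fix C\<^sub>l\<^sub>i\<^sub>n q\<^sub>l\<^sub>i\<^sub>n :: real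
      assume lin: "0 < C\<^sub>l\<^sub>i\<^sub>n" "0 < q\<^sub>l\<^sub>i\<^sub>n" "q\<^sub>l\<^sub>i\<^sub>n < 1"
      define C\<^sub>o\<^sub>p\<^sub>t where "C\<^sub>o\<^sub>p\<^sub>t = max (2 * C\<^sub>m\<^sub>e\<^sub>s\<^sub>h * C\<^sub>m\<^sub>a\<^sub>r\<^sub>k * C\<^sub>r\<^sub>e\<^sub>l)
        (monotonicity_const C\<^sub>s\<^sub>t\<^sub>b C\<^sub>r\<^sub>e\<^sub>d C\<^sub>d\<^sub>i\<^sub>s\<^sub>t C\<^sub>r\<^sub>e\<^sub>l * C\<^sub>l\<^sub>i\<^sub>n / \<kappa>)"
      have "0 < 2 * C\<^sub>m\<^sub>e\<^sub>s\<^sub>h * C\<^sub>m\<^sub>a\<^sub>r\<^sub>k * C\<^sub>r\<^sub>e\<^sub>l"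
        using assms by simp
      then have Copt: "0 < C\<^sub>o\<^sub>p\<^sub>t"
        unfolding C\<^sub>o\<^sub>p\<^sub>t_def by (rule less_le_trans) simp
      show "\<exists>C\<^sub>o\<^sub>p\<^sub>t>0. \<forall>(refine :: 'e mesh \<Rightarrow> 'e mesh \<Rightarrow> 'e mesh) T0 \<eta> d T M.
            goal_adaptive_setting \<theta> C\<^sub>m\<^sub>a\<^sub>r\<^sub>k C\<^sub>m\<^sub>e\<^sub>s\<^sub>h C\<^sub>d\<^sub>i\<^sub>s\<^sub>t C\<^sub>s\<^sub>t\<^sub>b q\<^sub>r\<^sub>e\<^sub>d C\<^sub>r\<^sub>e\<^sub>d C\<^sub>o\<^sub>r\<^sub>t\<^sub>h C\<^sub>r\<^sub>e\<^sub>l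
              refine T0 \<eta> d T M \<and>
            linear_convergence C\<^sub>l\<^sub>i\<^sub>n q\<^sub>l\<^sub>i\<^sub>n T (\<eta> Primal) (\<eta> Dual) \<longrightarrow>
            (\<forall>s>0. \<forall>t>0.
               approx_norm refine T0 (\<eta> Primal) s < \<infinity> \<and> approx_norm refine T0 (\<eta> Dual) t < \<infinity> \<longrightarrow>
               (\<forall>l. card (T l) \<noteq> card T0 \<longrightarrow>
                  ereal (total_est (\<eta> Primal) (T l) * total_est (\<eta> Dual) (T l))
                    \<le> ereal (C\<^sub>o\<^sub>p\<^sub>t powr (1 + s + t) / (1 - q\<^sub>l\<^sub>i\<^sub>n powr (1 / (s + t))) powr (s + t))
                       * approx_norm refine T0 (\<eta> Primal) s * approx_norm refine T0 (\<eta> Dual) t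
                       * ereal ((real (card (T l)) - real (card T0)) powr - (s + t))))"
      proof (rule exI[of _ C\<^sub>o\<^sub>p\<^sub>t], intro conjI allI impI Copt, elim conjE)
        fix refine :: "'e mesh \<Rightarrow> 'e mesh \<Rightarrow> 'e mesh" and T0 \<eta> d T M and s t :: real and l
        assume setting: "goal_adaptive_setting \<theta> C\<^sub>m\<^sub>a\<^sub>r\<^sub>k C\<^sub>m\<^sub>e\<^sub>s\<^sub>h C\<^sub>d\<^sub>i\<^sub>s\<^sub>t C\<^sub>s\<^sub>t\<^sub>b q\<^sub>r\<^sub>e\<^sub>d C\<^sub>r\<^sub>e\<^sub>d C\<^sub>o\<^sub>r\<^sub>t\<^sub>h C\<^sub>r\<^sub>e\<^sub>l
            refine T0 \<eta> d T M"
          and conv: "linear_convergence C\<^sub>l\<^sub>i\<^sub>n q\<^sub>l\<^sub>i\<^sub>n T (\<eta> Primal) (\<eta> Dual)"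
          and st: "0 < s" "0 < t"
          and norms: "approx_norm refine T0 (\<eta> Primal) s < \<infinity>" "approx_norm refine T0 (\<eta> Dual) t < \<infinity>"
          and refined: "card (T l) \<noteq> card T0"
        interpret goal_adaptive \<theta> C\<^sub>m\<^sub>a\<^sub>r\<^sub>k C\<^sub>m\<^sub>e\<^sub>s\<^sub>h C\<^sub>d\<^sub>i\<^sub>s\<^sub>t C\<^sub>s\<^sub>t\<^sub>b q\<^sub>r\<^sub>e\<^sub>d C\<^sub>r\<^sub>e\<^sub>d C\<^sub>r\<^sub>e\<^sub>l C\<^sub>o\<^sub>r\<^sub>t\<^sub>h refine T0 \<eta> d T M
          by (rule run[OF setting])
        obtain A where A: "0 \<le> A" "approx_norm refine T0 (\<eta> Primal) s = ereal A"
            "\<And>N. best_est refine T0 (\<eta> Primal) N \<le> A * (real N + 1) powr - s"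
          using approx_norm_finite[OF norms(1)] by metis
        obtain B where B: "0 \<le> B" "approx_norm refine T0 (\<eta> Dual) t = ereal B"
            "\<And>N. best_est refine T0 (\<eta> Dual) N \<le> B * (real N + 1) powr - t"
          using approx_norm_finite[OF norms(2)] by metis
        have "2 * C\<^sub>m\<^sub>e\<^sub>s\<^sub>h * C\<^sub>m\<^sub>a\<^sub>r\<^sub>k * C\<^sub>r\<^sub>e\<^sub>l \<le> C\<^sub>o\<^sub>p\<^sub>t" "C\<^sub>m\<^sub>o\<^sub>n * C\<^sub>l\<^sub>i\<^sub>n / \<kappa> \<le> C\<^sub>o\<^sub>p\<^sub>t"
          by (simp_all add: C\<^sub>o\<^sub>p\<^sub>t_def)
        from product_rate[OF \<delta>\<kappa> param lin conv this st A(1) B(1) A(3) B(3) refined]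
        show "ereal (total_est (\<eta> Primal) (T l) * total_est (\<eta> Dual) (T l))
            \<le> ereal (C\<^sub>o\<^sub>p\<^sub>t powr (1 + s + t) / (1 - q\<^sub>l\<^sub>i\<^sub>n powr (1 / (s + t))) powr (s + t))
               * approx_norm refine T0 (\<eta> Primal) s * approx_norm refine T0 (\<eta> Dual) t
               * ereal ((real (card (T l)) - real (card T0)) powr - (s + t))"
          unfolding A(2) B(2) by simp
      qed
    qed
  next
    case 2
    show ?case
      using goal_adaptive.individual_rates[OF run \<delta>\<kappa> param] by blast
  qed
qed

end
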